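(* Let $S$ be a closed, connected, oriented surface of genus $\tau\geq 2$, let $h$ be a hyperbolic metric on $S$ and let $q_{1}$ be a non-zero quadratic differential on $S$, holomorphic for the complex structure compatible with $h$. For $t>0$ let $I_{t}$ be the induced metric on the unique maximal surface embedded in the GHMC anti-de Sitter manifold $M_{t}$ parameterised by $(h,tq_{1})\in T^{*}\mathrm{Teich}(S)$. Then, outside the zeros of $q_{1}$, $$\frac{I_{t}}{t}\to |q_{1}| \quad\text{when } t\to+\infty,$$ monotonically from above (that is, at every point of $S$ outside the zeros of $q_{1}$, $\frac{I_{t}}{t}$ is monotone decreasing in $t>0$, bounded from below by $|q_{1}|$, and converges to $|q_{1}|$).
   Context: A GHMC (globally hyperbolic maximal Cauchy-compact) anti-de Sitter manifold is a Lorentzian $3$-manifold of constant sectional curvature $-1$ containing an embedded closed oriented surface (Cauchy surface) meeting every inextensible causal curve in exactly one point, and maximal under isometric embeddings sending a Cauchy surface to a Cauchy surface. Every GHMC anti-de Sitter manifold contains a unique embedded maximal surface (i.e. space-like with vanishing mean curvature). GHMC structures on $S\times\mathbb{R}$ (up to diffeomorphisms isotopic to the identity) are parameterised by pairs $(h,q)\in T^{*}\mathrm{Teich}(S)$, $h$ hyperbolic and $q$ a holomorphic quadratic differential for the conformal structure of $h$: the manifold corresponding to $(h,q)$ is the one whose maximal surface has induced metric $I=e^{2u}h$ and shape operator $B=I^{-1}\Re(q)$, where $u:S\to\mathbb{R}$ is the unique smooth solution of $$\Delta_{h}u=e^{2u}-e^{-2u}\|q\|_{h}^{2}-1 .$$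 Here $\Delta_{h}$ is the non-positive Laplacian (so that $K_{e^{2u}h}=e^{-2u}(K_{h}-\Delta_{h}u)$), and $\|q\|_{h}=|f|e^{-2v}$ if $q=f\,dz^{2}$ and $h=e^{2v}|dz|^{2}$ in a conformal coordinate $z$. Thus $I_{t}=e^{2u_{t}}h$ where $u_{t}$ solves this equation for $q=tq_{1}$. $|q_{1}|$ denotes the flat metric with conical singularities given locally by $|f||dz|^{2}$ if $q_{1}=f\,dz^{2}$; equivalently $|q_{1}|=\|q_{1}\|_{h}h$. *)

theory Defs
  imports "HOL-Analysis.Analysis" "HOL-Homology.Homology"
begin

section \<open>Smooth manifolds\<close>

text \<open>\<open>C_k_on\<close> and \<open>smooth_on\<close> are only meant for open sets.\<close>

primrec C_k_on :: "nat \<Rightarrow> 'e::euclidean_space set \<Rightarrow> ('e \<Rightarrow> 'f::euclidean_space) \<Rightarrow> bool" where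
  "C_k_on 0 U f \<longleftrightarrow> continuous_on U f"
| "C_k_on (Suc k) U f \<longleftrightarrow>
     (\<forall>x\<in>U. f differentiable (at x)) \<and> (\<forall>v. C_k_on k U (\<lambda>x. frechet_derivative f (at x) v))"

definition smooth_on :: "'e::euclidean_space set \<Rightarrow> ('e \<Rightarrow> 'f::euclidean_space) \<Rightarrow> bool" where
  "smooth_on U f \<longleftrightarrow> (\<forall>k. C_k_on k U f)"

text \<open>A chart is a pair of a domain and a coordinate map; the model space \<open>'e\<close> fixes the dimension.\<close>

type_synonym ('a, 'e) chart = "'a set \<times> ('a \<Rightarrow> 'e)"

abbreviation cdom :: "('a, 'e) chart \<Rightarrow> 'a set" where "cdom c \<equiv> fst c"
abbreviation cmap :: "('a, 'e) chart \<Rightarrow> 'a \<Rightarrow> 'e" where "cmap c \<equiv> snd c"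
abbreviation cimg :: "('a, 'e) chart \<Rightarrow> 'e set" where "cimg c \<equiv> cmap c ` cdom c"
abbreviation cinv :: "('a, 'e) chart \<Rightarrow> 'e \<Rightarrow> 'a" where "cinv c \<equiv> inv_into (cdom c) (cmap c)"

text \<open>Expression of \<open>f\<close> in the charts \<open>c\<close> (source) and \<open>d\<close> (target), and the set of
  coordinates on which it is meaningful. With \<open>f = id\<close> this is the change of coordinates.\<close>

definition loc :: "('a, 'e) chart \<Rightarrow> ('b, 'f) chart \<Rightarrow> ('a \<Rightarrow> 'b) \<Rightarrow> 'e \<Rightarrow> 'f" where
  "loc c d f = cmap d \<circ> f \<circ> cinv c"

definition locdom :: "('a, 'e) chart \<Rightarrow> ('b, 'f) chart \<Rightarrow> ('a \<Rightarrow> 'b) \<Rightarrow> 'e set" where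
  "locdom c d f = cmap c ` (cdom c \<inter> f -` cdom d)"

abbreviation loc_deriv ::
  "('a, 'e::euclidean_space) chart \<Rightarrow> ('b, 'f::euclidean_space) chart \<Rightarrow> ('a \<Rightarrow> 'b) \<Rightarrow> 'e \<Rightarrow> 'e \<Rightarrow> 'f" where
  "loc_deriv c d f x \<equiv> frechet_derivative (loc c d f) (at x)"

record ('a, 'e) mfd =
  mtop :: "'a topology"
  atlas :: "('a, 'e) chart set"

text \<open>Atlases are not required to be maximal.\<close>

definition smooth_manifold :: "('a, 'e::euclidean_space) mfd \<Rightarrow> bool" where
  "smooth_manifold X \<longleftrightarrow>
     Hausdorff_space (mtop X) \<and> second_countable (mtop X) \<and>
     (\<Union>c\<in>atlas X. cdom c) = topspace (mtop X) \<and>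
     (\<forall>c\<in>atlas X. openin (mtop X) (cdom c) \<and> open (cimg c) \<and>
        homeomorphic_map (subtopology (mtop X) (cdom c)) (top_of_set (cimg c)) (cmap c)) \<and>
     (\<forall>c\<in>atlas X. \<forall>d\<in>atlas X. smooth_on (locdom c d id) (loc c d id))"

definition smooth_map ::
  "('a, 'e::euclidean_space) mfd \<Rightarrow> ('b, 'f::euclidean_space) mfd \<Rightarrow> ('a \<Rightarrow> 'b) \<Rightarrow> bool" where
  "smooth_map X Y f \<longleftrightarrow> continuous_map (mtop X) (mtop Y) f \<and>
     (\<forall>c\<in>atlas X. \<forall>d\<in>atlas Y. smooth_on (locdom c d f) (loc c d f))"

definition smooth_function :: "('a, 'e::euclidean_space) mfd \<Rightarrow> ('a \<Rightarrow> real) \<Rightarrow> bool" where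
  "smooth_function X f \<longleftrightarrow> (\<forall>c\<in>atlas X. smooth_on (cimg c) (f \<circ> cinv c))"

definition smooth_embedding ::
  "('a, 'e::euclidean_space) mfd \<Rightarrow> ('b, 'f::euclidean_space) mfd \<Rightarrow> ('a \<Rightarrow> 'b) \<Rightarrow> bool" where
  "smooth_embedding X Y f \<longleftrightarrow> smooth_map X Y f \<and> embedding_map (mtop X) (mtop Y) f \<and>
     (\<forall>c\<in>atlas X. \<forall>d\<in>atlas Y. \<forall>x\<in>locdom c d f. inj (loc_deriv c d f x))"

section \<open>Pseudo-Riemannian metrics\<close>

text \<open>A covariant 2-tensor field is given by its expression in each chart: chart, point of the
  chart image, two tangent vectors.\<close>

type_synonym ('a, 'e) tensor2 = "('a, 'e) chart \<Rightarrow> 'e \<Rightarrow> 'e \<Rightarrow> 'e \<Rightarrow> real"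

definition sym_tensor :: "('a, 'e::euclidean_space) mfd \<Rightarrow> ('a, 'e) tensor2 \<Rightarrow> bool" where
  "sym_tensor X g \<longleftrightarrow>
     (\<forall>c\<in>atlas X. \<forall>x\<in>cimg c. bilinear (g c x) \<and> (\<forall>v w. g c x v w = g c x w v)) \<and>
     (\<forall>c\<in>atlas X. \<forall>v w. smooth_on (cimg c) (\<lambda>x. g c x v w)) \<and>
     (\<forall>c\<in>atlas X. \<forall>d\<in>atlas X. \<forall>x\<in>locdom c d id. \<forall>v w.
        g c x v w = g d (loc c d id x) (loc_deriv c d id x v) (loc_deriv c d id x w))"

definition riemannian :: "('a, 'e::euclidean_space) mfd \<Rightarrow> ('a, 'e) tensor2 \<Rightarrow> bool" where
  "riemannian X g \<longleftrightarrow> sym_tensor X g \<and>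
     (\<forall>c\<in>atlas X. \<forall>x\<in>cimg c. \<forall>v. v \<noteq> 0 \<longrightarrow> 0 < g c x v v)"

text \<open>Lorentzian: signature \<open>(n - 1, 1)\<close>, the negative direction being time.\<close>

definition lorentzian :: "('a, 'e::euclidean_space) mfd \<Rightarrow> ('a, 'e) tensor2 \<Rightarrow> bool" where
  "lorentzian X g \<longleftrightarrow> sym_tensor X g \<and>
     (\<forall>c\<in>atlas X. \<forall>x\<in>cimg c. \<exists>e. g c x e e < 0 \<and>
        (\<forall>v. v \<noteq> 0 \<and> g c x e v = 0 \<longrightarrow> 0 < g c x v v))"

text \<open>\<open>G\<close> is the expression of a metric in one chart. The vector \<open>christoffel G x v w\<close> is
  $\Gamma^k_{ij} v^i w^j$, i.e. the covariant derivative along \<open>v\<close> of the field with constant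
  coordinates \<open>w\<close>, given by the Koszul formula.\<close>

definition christoffel ::
  "('e::euclidean_space \<Rightarrow> 'e \<Rightarrow> 'e \<Rightarrow> real) \<Rightarrow> 'e \<Rightarrow> 'e \<Rightarrow> 'e \<Rightarrow> 'e" where
  "christoffel G x v w = (THE u. \<forall>z. G x u z =
     (frechet_derivative (\<lambda>y. G y w z) (at x) v +
      frechet_derivative (\<lambda>y. G y v z) (at x) w -
      frechet_derivative (\<lambda>y. G y v w) (at x) z) / 2)"

text \<open>$R(v,w)z = \nabla_v \nabla_w z - \nabla_w \nabla_v z$ for fields with constant coordinates.\<close>

definition riemann_curvature ::
  "('e::euclidean_space \<Rightarrow> 'e \<Rightarrow> 'e \<Rightarrow> real) \<Rightarrow> 'e \<Rightarrow> 'e \<Rightarrow> 'e \<Rightarrow> 'e \<Rightarrow> 'e" where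
  "riemann_curvature G x v w z =
     (frechet_derivative (\<lambda>y. christoffel G y w z) (at x) v
        + christoffel G x v (christoffel G x w z))
   - (frechet_derivative (\<lambda>y. christoffel G y v z) (at x) w
        + christoffel G x w (christoffel G x v z))"

definition constant_sectional_curvature ::
  "('a, 'e::euclidean_space) mfd \<Rightarrow> ('a, 'e) tensor2 \<Rightarrow> real \<Rightarrow> bool" where
  "constant_sectional_curvature X g K \<longleftrightarrow>
     (\<forall>c\<in>atlas X. \<forall>x\<in>cimg c. \<forall>v w.
        let Q = g c x v v * g c x w w - (g c x v w)\<^sup>2
        in Q \<noteq> 0 \<longrightarrow> g c x (riemann_curvature (g c) x v w w) v / Q = K)"

definition endo_trace :: "('e::euclidean_space \<Rightarrow> 'e) \<Rightarrow> real" where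
  "endo_trace L = (\<Sum>i\<in>Basis. L i \<bullet> i)"

definition hessian ::
  "('e::euclidean_space \<Rightarrow> 'e \<Rightarrow> 'e \<Rightarrow> real) \<Rightarrow> ('e \<Rightarrow> real) \<Rightarrow> 'e \<Rightarrow> 'e \<Rightarrow> 'e \<Rightarrow> real" where
  "hessian G f x v w =
     frechet_derivative (\<lambda>y. frechet_derivative f (at y) w) (at x) v
   - frechet_derivative f (at x) (christoffel G x v w)"

text \<open>The Laplacian is the trace, with respect to the metric, of the Hessian (the non-positive Laplacian).\<close>

definition laplacian ::
  "('e::euclidean_space \<Rightarrow> 'e \<Rightarrow> 'e \<Rightarrow> real) \<Rightarrow> ('e \<Rightarrow> real) \<Rightarrow> 'e \<Rightarrow> real" where
  "laplacian G f x = endo_trace (\<lambda>v. THE u. \<forall>w. G x u w = hessian G f x v w)"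

text \<open>\<open>I\<close> is the pull-back \<open>f\<^sup>* g\<close>.\<close>

definition induced_metric ::
  "('a, 'e::euclidean_space) mfd \<Rightarrow> ('b, 'f::euclidean_space) mfd \<Rightarrow> ('b, 'f) tensor2 \<Rightarrow>
   ('a \<Rightarrow> 'b) \<Rightarrow> ('a, 'e) tensor2 \<Rightarrow> bool" where
  "induced_metric X Y g f I \<longleftrightarrow>
     (\<forall>c\<in>atlas X. \<forall>d\<in>atlas Y. \<forall>x\<in>locdom c d f. \<forall>v w.
        I c x v w = g d (loc c d f x) (loc_deriv c d f x v) (loc_deriv c d f x w))"

section \<open>Surfaces, complex structures, quadratic differentials\<close>

text \<open>The model of surfaces is the type \<^typ>\<open>complex\<close>, seen as the oriented real plane. The real
  number \<open>Im (cnj (L 1) * L \<i>)\<close> is the determinant of the real-linear map \<open>L\<close>.\<close>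

definition closed_oriented_surface :: "('a, complex) mfd \<Rightarrow> bool" where
  "closed_oriented_surface S \<longleftrightarrow>
     smooth_manifold S \<and> compact_space (mtop S) \<and> connected_space (mtop S) \<and>
     (\<forall>c\<in>atlas S. \<forall>d\<in>atlas S. \<forall>z\<in>locdom c d id.
        0 < Im (cnj (loc_deriv c d id z 1) * loc_deriv c d id z \<i>))"

text \<open>For a closed connected oriented surface, the first homology is free abelian of rank twice
  the genus.\<close>

definition has_genus :: "('a, complex) mfd \<Rightarrow> nat \<Rightarrow> bool" where
  "has_genus S \<tau> \<longleftrightarrow> homology_group 1 (mtop S) \<cong> free_Abelian_group {..<2 * \<tau>}"

definition hyperbolic_metric :: "('a, complex) mfd \<Rightarrow> ('a, complex) tensor2 \<Rightarrow> bool" where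
  "hyperbolic_metric S h \<longleftrightarrow> riemannian S h \<and> constant_sectional_curvature S h (-1)"

text \<open>The complex structure compatible with \<open>h\<close> (and the orientation) is presented by a
  holomorphic atlas \<open>C\<close> of oriented charts in which \<open>h\<close> reads $e^{2v}|dz|^2$. Since the oriented
  atlas of \<open>S\<close> may be taken maximal, membership of these charts in it is no restriction.\<close>

definition compatible_complex_structure ::
  "('a, complex) mfd \<Rightarrow> ('a, complex) tensor2 \<Rightarrow> ('a, complex) chart set \<Rightarrow> bool" where
  "compatible_complex_structure S h C \<longleftrightarrow>
     C \<subseteq> atlas S \<and> (\<Union>c\<in>C. cdom c) = topspace (mtop S) \<and>
     (\<forall>c\<in>C. \<forall>d\<in>C. (loc c d id) holomorphic_on (locdom c d id)) \<and>
     (\<forall>c\<in>C. \<forall>z\<in>cimg c. \<exists>v. \<forall>a b. h c z a b = exp (2 * v) * (a \<bullet> b))"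

text \<open>A quadratic differential is given by the coefficient \<open>f\<close> of \<open>f dz\<^sup>2\<close> in each chart of the
  complex atlas.\<close>

type_synonym 'a quad_diff = "('a, complex) chart \<Rightarrow> complex \<Rightarrow> complex"

definition holomorphic_quad_diff :: "('a, complex) chart set \<Rightarrow> 'a quad_diff \<Rightarrow> bool" where
  "holomorphic_quad_diff C q \<longleftrightarrow>
     (\<forall>c\<in>C. (q c) holomorphic_on (cimg c)) \<and>
     (\<forall>c\<in>C. \<forall>d\<in>C. \<forall>z\<in>locdom c d id.
        q c z = q d (loc c d id z) * (deriv (loc c d id) z)\<^sup>2)"

definition re_quad :: "'a quad_diff \<Rightarrow> ('a, complex) tensor2" where
  "re_quad q c z v w = Re (q c z * v * w)"

definition flat_metric :: "'a quad_diff \<Rightarrow> ('a, complex) tensor2" where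
  "flat_metric q c z v w = cmod (q c z) * (v \<bullet> w)"

text \<open>In a conformal chart the factor $e^{2v}$ of \<open>h\<close> is \<open>h c z 1 1\<close>.\<close>

definition quad_norm :: "('a, complex) tensor2 \<Rightarrow> 'a quad_diff \<Rightarrow> ('a, complex) chart \<Rightarrow> complex \<Rightarrow> real" where
  "quad_norm h q c z = cmod (q c z) / h c z 1 1"

definition conformal_metric :: "('a \<Rightarrow> real) \<Rightarrow> ('a, complex) tensor2 \<Rightarrow> ('a, complex) tensor2" where
  "conformal_metric u h c z v w = exp (2 * u (cinv c z)) * h c z v w"

definition gauss_equation_sol ::
  "('a, complex) mfd \<Rightarrow> ('a, complex) tensor2 \<Rightarrow> ('a, complex) chart set \<Rightarrow> 'a quad_diff \<Rightarrow>
   ('a \<Rightarrow> real) \<Rightarrow> bool" where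
  "gauss_equation_sol S h C q u \<longleftrightarrow> smooth_function S u \<and>
     (\<forall>c\<in>C. \<forall>p\<in>cdom c.
        laplacian (h c) (u \<circ> cinv c) (cmap c p) =
          exp (2 * u p) - exp (- 2 * u p) * (quad_norm h q c (cmap c p))\<^sup>2 - 1)"

section \<open>GHMC anti-de Sitter manifolds\<close>

text \<open>Causal curves without end points. Every open interval is diffeomorphic to the real line, so
  taking the whole line as parameter space loses no generality.\<close>

definition inextensible_causal_curve ::
  "('a, 'e::euclidean_space) mfd \<Rightarrow> ('a, 'e) tensor2 \<Rightarrow> (real \<Rightarrow> 'a) \<Rightarrow> bool" where
  "inextensible_causal_curve M g \<gamma> \<longleftrightarrow>
     continuous_map euclideanreal (mtop M) \<gamma> \<and>
     (\<forall>d\<in>atlas M. C_k_on 1 (\<gamma> -` cdom d) (cmap d \<circ> \<gamma>) \<and>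
        (\<forall>s. \<gamma> s \<in> cdom d \<longrightarrow>
           (let v = vector_derivative (cmap d \<circ> \<gamma>) (at s)
            in v \<noteq> 0 \<and> g d (cmap d (\<gamma> s)) v v \<le> 0))) \<and>
     (\<nexists>p. limitin (mtop M) \<gamma> p at_top) \<and> (\<nexists>p. limitin (mtop M) \<gamma> p at_bot)"

definition embedded_closed_oriented_surface :: "('a, 'e::euclidean_space) mfd \<Rightarrow> 'a set \<Rightarrow> bool" where
  "embedded_closed_oriented_surface M F \<longleftrightarrow> F \<subseteq> topspace (mtop M) \<and>
     (\<exists>S. mtop S = subtopology (mtop M) F \<and> closed_oriented_surface S \<and> smooth_embedding S M id)"

definition cauchy_surface ::
  "('a, 'e::euclidean_space) mfd \<Rightarrow> ('a, 'e) tensor2 \<Rightarrow> 'a set \<Rightarrow> bool" where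
  "cauchy_surface M g F \<longleftrightarrow> embedded_closed_oriented_surface M F \<and>
     (\<forall>\<gamma>. inextensible_causal_curve M g \<gamma> \<longrightarrow> (\<exists>!s. \<gamma> s \<in> F))"

definition ads_manifold :: "('b, real^3) mfd \<Rightarrow> ('b, real^3) tensor2 \<Rightarrow> bool" where
  "ads_manifold M g \<longleftrightarrow> smooth_manifold M \<and> connected_space (mtop M) \<and>
     lorentzian M g \<and> constant_sectional_curvature M g (-1)"

definition isometric_embedding ::
  "('b, real^3) mfd \<Rightarrow> ('b, real^3) tensor2 \<Rightarrow> ('b, real^3) mfd \<Rightarrow> ('b, real^3) tensor2 \<Rightarrow>
   ('b \<Rightarrow> 'b) \<Rightarrow> bool" where
  "isometric_embedding M g N g' f \<longleftrightarrow> smooth_embedding M N f \<and> induced_metric M N g' f g"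

text \<open>Maximality: an isometric embedding into an anti-de Sitter manifold which sends a Cauchy surface
  to a Cauchy surface is onto. The competitor \<open>N\<close> has points in the same type as \<open>M\<close>: non-empty
  connected 3-manifolds all have the cardinality of the continuum, so any competitor can be
  transported there.\<close>

definition ghmc_ads_manifold :: "('b, real^3) mfd \<Rightarrow> ('b, real^3) tensor2 \<Rightarrow> bool" where
  "ghmc_ads_manifold M g \<longleftrightarrow> ads_manifold M g \<and> (\<exists>F. cauchy_surface M g F) \<and>
     (\<forall>N g' f. ads_manifold N g' \<and> isometric_embedding M g N g' f \<and>
        (\<exists>F. cauchy_surface M g F \<and> cauchy_surface N g' (f ` F))
        \<longrightarrow> f ` topspace (mtop M) = topspace (mtop N))"

section \<open>Maximal surfaces and the parameterisation\<close>

text \<open>\<open>\<nu> d p\<close> is the expression in the chart \<open>d\<close> of \<open>M\<close> of the unit normal at \<open>\<sigma> p\<close>; it is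
  time-like.\<close>

definition unit_normal ::
  "('a, complex) mfd \<Rightarrow> ('b, real^3) mfd \<Rightarrow> ('b, real^3) tensor2 \<Rightarrow> ('a \<Rightarrow> 'b) \<Rightarrow>
   (('b, real^3) chart \<Rightarrow> 'a \<Rightarrow> real^3) \<Rightarrow> bool" where
  "unit_normal S M g \<sigma> \<nu> \<longleftrightarrow>
     (\<forall>d\<in>atlas M. \<forall>e\<in>atlas M. \<forall>p\<in>topspace (mtop S). \<sigma> p \<in> cdom d \<inter> cdom e \<longrightarrow>
        \<nu> e p = loc_deriv d e id (cmap d (\<sigma> p)) (\<nu> d p)) \<and>
     (\<forall>c\<in>atlas S. \<forall>d\<in>atlas M. smooth_on (locdom c d \<sigma>) (\<nu> d \<circ> cinv c) \<and>
        (\<forall>x\<in>locdom c d \<sigma>.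
           g d (loc c d \<sigma> x) (\<nu> d (cinv c x)) (\<nu> d (cinv c x)) = -1 \<and>
           (\<forall>v. g d (loc c d \<sigma> x) (\<nu> d (cinv c x)) (loc_deriv c d \<sigma> x v) = 0)))"

text \<open>$d\sigma(Bv) = \nabla_v \nu$. The opposite sign convention amounts to replacing \<open>\<nu>\<close> by \<open>- \<nu>\<close>.\<close>

definition shape_operator ::
  "('a, complex) mfd \<Rightarrow> ('b, real^3) mfd \<Rightarrow> ('b, real^3) tensor2 \<Rightarrow> ('a \<Rightarrow> 'b) \<Rightarrow>
   (('b, real^3) chart \<Rightarrow> 'a \<Rightarrow> real^3) \<Rightarrow>
   (('a, complex) chart \<Rightarrow> complex \<Rightarrow> complex \<Rightarrow> complex) \<Rightarrow> bool" where
  "shape_operator S M g \<sigma> \<nu> B \<longleftrightarrow>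
     (\<forall>c\<in>atlas S. \<forall>d\<in>atlas M. \<forall>x\<in>locdom c d \<sigma>. \<forall>v.
        loc_deriv c d \<sigma> x (B c x v) =
          frechet_derivative (\<nu> d \<circ> cinv c) (at x) v
          + christoffel (g d) (loc c d \<sigma> x) (loc_deriv c d \<sigma> x v) (\<nu> d (cinv c x)))"

text \<open>Space-like embedding \<open>\<sigma>\<close> of \<open>S\<close> in \<open>M\<close> with vanishing mean curvature, with its first
  fundamental form \<open>I\<close> and its shape operator \<open>B\<close>.\<close>

definition maximal_surface ::
  "('a, complex) mfd \<Rightarrow> ('b, real^3) mfd \<Rightarrow> ('b, real^3) tensor2 \<Rightarrow> ('a \<Rightarrow> 'b) \<Rightarrow>
   ('a, complex) tensor2 \<Rightarrow> (('a, complex) chart \<Rightarrow> complex \<Rightarrow> complex \<Rightarrow> complex) \<Rightarrow> bool" where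
  "maximal_surface S M g \<sigma> I B \<longleftrightarrow>
     smooth_embedding S M \<sigma> \<and> induced_metric S M g \<sigma> I \<and> riemannian S I \<and>
     (\<exists>\<nu>. unit_normal S M g \<sigma> \<nu> \<and> shape_operator S M g \<sigma> \<nu> B) \<and>
     (\<forall>c\<in>atlas S. \<forall>z\<in>cimg c. endo_trace (B c z) = 0)"

text \<open>\<open>(M, g)\<close> is the GHMC anti-de Sitter manifold with parameters \<open>(h, q)\<close>, \<open>\<sigma>\<close> being the marking
  which identifies \<open>S\<close> with the maximal surface of \<open>M\<close>. The last clause is $B = I^{-1}\Re(q)$.\<close>

definition parameterised_by ::
  "('a, complex) mfd \<Rightarrow> ('a, complex) tensor2 \<Rightarrow> ('a, complex) chart set \<Rightarrow> 'a quad_diff \<Rightarrow>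
   ('b, real^3) mfd \<Rightarrow> ('b, real^3) tensor2 \<Rightarrow> ('a \<Rightarrow> 'b) \<Rightarrow> bool" where
  "parameterised_by S h C q M g \<sigma> \<longleftrightarrow> ghmc_ads_manifold M g \<and>
     (\<exists>u B. gauss_equation_sol S h C q u \<and>
        maximal_surface S M g \<sigma> (conformal_metric u h) B \<and>
        (\<forall>c\<in>C. \<forall>z\<in>cimg c. \<forall>v w.
           conformal_metric u h c z (B c z v) w = re_quad q c z v w))"

end

theory Submission
  imports Defs "HOL-Complex_Analysis.Complex_Analysis"
begin

text \<open>In a conformal chart write \<open>h = E |dz|\<^sup>2\<close>, \<open>q\<^sub>1 = f dz\<^sup>2\<close> and
  \<open>I\<^sub>t / t = exp (2 \<Phi>\<^sub>t) |dz|\<^sup>2\<close>. Since \<open>h\<close> has curvature \<open>-1\<close>, the equation for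
  \<open>u\<^sub>t\<close> becomes \<open>\<Delta> \<Phi>\<^sub>t = t (exp (2 \<Phi>\<^sub>t) - exp (-2 \<Phi>\<^sub>t) |f|\<^sup>2)\<close> with the flat
  Laplacian, and everything follows from the maximum principle. As \<open>ln |f|\<close> is harmonic, looking
  at a maximum of \<open>|f| exp (-2 \<Phi>\<^sub>t)\<close>, a function on \<open>S\<close>, gives \<open>|f| \<le> exp (2 \<Phi>\<^sub>t)\<close>.
  Hence the right-hand side is non-negative, and a maximum of \<open>\<Phi>\<^sub>t - \<Phi>\<^sub>s\<close> (again a function
  on \<open>S\<close>) shows that \<open>\<Phi>\<^sub>t \<le> \<Phi>\<^sub>s\<close> for \<open>s \<le> t\<close>. Finally, near a point with
  \<open>f \<noteq> 0\<close> the function \<open>\<psi>\<^sub>t = \<Phi>\<^sub>t - ln |f| / 2 \<ge> 0\<close> is bounded for \<open>t \<ge> 1\<close> and satisfies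
  \<open>\<Delta> \<psi>\<^sub>t \<ge> 2 t |f| \<psi>\<^sub>t\<close>; comparison with a quadratic barrier yields \<open>\<psi>\<^sub>t = O(1/t)\<close>.\<close>

section \<open>Second derivatives and the flat Laplacian\<close>

text \<open>Second derivatives are only asked to exist at each point, which is what the second
  derivative test uses; smooth functions, logarithms and real parts of holomorphic functions all
  qualify.\<close>

definition twice_differentiable_on ::
  "('e::euclidean_space \<Rightarrow> real) \<Rightarrow> 'e set \<Rightarrow> bool" (infix "twice'_differentiable'_on" 50) where
  "f twice_differentiable_on U \<longleftrightarrow>
     (\<forall>x\<in>U. f differentiable (at x)) \<and>
     (\<forall>x\<in>U. \<forall>v. (\<lambda>y. frechet_derivative f (at y) v) differentiable (at x))"

definition second_deriv :: "('e::euclidean_space \<Rightarrow> real) \<Rightarrow> 'e \<Rightarrow> 'e \<Rightarrow> 'e \<Rightarrow> real" where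
  "second_deriv f x v w = frechet_derivative (\<lambda>y. frechet_derivative f (at y) v) (at x) w"

definition flat_laplacian :: "('e::euclidean_space \<Rightarrow> real) \<Rightarrow> 'e \<Rightarrow> real" where
  "flat_laplacian f x = (\<Sum>e\<in>Basis. second_deriv f x e e)"

lemma twice_differentiable_onD:
  assumes "f twice_differentiable_on U" "x \<in> U"
  shows "(f has_derivative frechet_derivative f (at x)) (at x)"
    and "((\<lambda>y. frechet_derivative f (at y) v) has_derivative second_deriv f x v) (at x)"
  using assms unfolding twice_differentiable_on_def second_deriv_def
  by (auto simp: frechet_derivative_works)

text \<open>Lets \<open>f'\<close> and \<open>f''\<close> be supplied by the derivative rules. Since
  \<open>U\<close> is open, \<open>frechet_derivative f\<close> agrees with \<open>f'\<close> near
  each point of \<open>U\<close>, so the two have the same derivative there.\<close>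

lemma twice_differentiable_onI:
  assumes "open U"
    and f: "\<And>x. x \<in> U \<Longrightarrow> (f has_derivative f' x) (at x)"
    and f': "\<And>x v. x \<in> U \<Longrightarrow> ((\<lambda>y. f' y v) has_derivative f'' x v) (at x)"
  shows "f twice_differentiable_on U"
    and "x \<in> U \<Longrightarrow> second_deriv f x v w = f'' x v w"
proof -
  have eq: "frechet_derivative f (at x) = f' x" if "x \<in> U" for x
    by (rule frechet_derivative_at[OF f[OF that], symmetric])
  have 2: "((\<lambda>y. frechet_derivative f (at y) v) has_derivative f'' x v) (at x)" if "x \<in> U" for x v
    by (rule has_derivative_transform_within_open[OF f'[OF that] \<open>open U\<close> that]) (simp add: eq)
  show "f twice_differentiable_on U"
    unfolding twice_differentiable_on_def differentiable_def using f 2 by blast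
  show "second_deriv f x v w = f'' x v w" if "x \<in> U"
    unfolding second_deriv_def by (simp flip: frechet_derivative_at[OF 2[OF that]])
qed

lemma twice_differentiable_on_subset:
  "f twice_differentiable_on U \<Longrightarrow> V \<subseteq> U \<Longrightarrow> f twice_differentiable_on V"
  by (auto simp: twice_differentiable_on_def)

lemma twice_differentiable_imp_continuous_on:
  "f twice_differentiable_on U \<Longrightarrow> continuous_on U f"
  by (meson twice_differentiable_on_def differentiable_imp_continuous_within
      continuous_at_imp_continuous_on)

lemma smooth_on_imp_twice_differentiable_on: "smooth_on U f \<Longrightarrow> f twice_differentiable_on U"
  unfolding smooth_on_def twice_differentiable_on_def
  by (drule spec[of _ "Suc (Suc 0)"]) simp

lemma twice_differentiable_on_add:
  assumes "open U" "f twice_differentiable_on U" "g twice_differentiable_on U"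
  shows "(\<lambda>x. f x + g x) twice_differentiable_on U"
    and "x \<in> U \<Longrightarrow> flat_laplacian (\<lambda>x. f x + g x) x = flat_laplacian f x + flat_laplacian g x"
proof -
  have 1: "((\<lambda>x. f x + g x) has_derivative
      (\<lambda>v. frechet_derivative f (at x) v + frechet_derivative g (at x) v)) (at x)" if "x \<in> U" for x
    by (intro has_derivative_add twice_differentiable_onD(1)[where U = U] assms that)
  have 2: "((\<lambda>y. frechet_derivative f (at y) v + frechet_derivative g (at y) v) has_derivative
      (\<lambda>w. second_deriv f x v w + second_deriv g x v w)) (at x)" if "x \<in> U" for x v
    by (intro has_derivative_add twice_differentiable_onD(2)[where U = U] assms that)
  note I = twice_differentiable_onI[OF assms(1) 1 2]
  show "(\<lambda>x. f x + g x) twice_differentiable_on U" by (rule I(1))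
  show "flat_laplacian (\<lambda>x. f x + g x) x = flat_laplacian f x + flat_laplacian g x" if "x \<in> U"
    unfolding flat_laplacian_def using that by (simp add: I(2) sum.distrib)
qed

lemma twice_differentiable_on_diff:
  assumes "open U" "f twice_differentiable_on U" "g twice_differentiable_on U"
  shows "(\<lambda>x. f x - g x) twice_differentiable_on U"
    and "x \<in> U \<Longrightarrow> flat_laplacian (\<lambda>x. f x - g x) x = flat_laplacian f x - flat_laplacian g x"
proof -
  have 1: "((\<lambda>x. f x - g x) has_derivative
      (\<lambda>v. frechet_derivative f (at x) v - frechet_derivative g (at x) v)) (at x)" if "x \<in> U" for x
    by (intro has_derivative_diff twice_differentiable_onD(1)[where U = U] assms that)
  have 2: "((\<lambda>y. frechet_derivative f (at y) v - frechet_derivative g (at y) v) has_derivative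
      (\<lambda>w. second_deriv f x v w - second_deriv g x v w)) (at x)" if "x \<in> U" for x v
    by (intro has_derivative_diff twice_differentiable_onD(2)[where U = U] assms that)
  note I = twice_differentiable_onI[OF assms(1) 1 2]
  show "(\<lambda>x. f x - g x) twice_differentiable_on U" by (rule I(1))
  show "flat_laplacian (\<lambda>x. f x - g x) x = flat_laplacian f x - flat_laplacian g x" if "x \<in> U"
    unfolding flat_laplacian_def using that by (simp add: I(2) sum_subtractf)
qed

lemma twice_differentiable_on_const:
  assumes "open U"
  shows "(\<lambda>x. c) twice_differentiable_on U"
    and "x \<in> U \<Longrightarrow> flat_laplacian (\<lambda>x. c) x = 0"
proof -
  note I = twice_differentiable_onI[OF assms, of "\<lambda>x. c" "\<lambda>x v. 0" "\<lambda>x v w. 0"]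
  show "(\<lambda>x. c) twice_differentiable_on U" by (rule I(1)) auto
  show "x \<in> U \<Longrightarrow> flat_laplacian (\<lambda>x. c) x = 0"
    unfolding flat_laplacian_def by (rule sum.neutral, intro ballI, rule I(2)) auto
qed

text \<open>Meant for a conformal factor \<open>E\<close>. The Laplacian of \<open>ln E / 2\<close>
  will come from the curvature, so only regularity is recorded.\<close>

lemma twice_differentiable_on_half_ln:
  assumes "open U" "E twice_differentiable_on U" "\<And>x. x \<in> U \<Longrightarrow> 0 < E x"
  shows "(\<lambda>x. ln (E x) / 2) twice_differentiable_on U"
proof (rule twice_differentiable_onI(1)[OF assms(1)])
  show "((\<lambda>x. ln (E x) / 2) has_derivative (\<lambda>v. frechet_derivative E (at x) v / E x / 2)) (at x)"
    if "x \<in> U" for x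
    using assms(3)[OF that] twice_differentiable_onD(1)[OF assms(2) that]
    by (auto intro!: derivative_eq_intros simp: field_simps)
  show "((\<lambda>y. frechet_derivative E (at y) v / E y / 2) has_derivative
      (\<lambda>w. (second_deriv E x v w * E x - frechet_derivative E (at x) v * frechet_derivative E (at x) w)
         / (E x * E x) / 2)) (at x)" if "x \<in> U" for x v
    using assms(3)[OF that] twice_differentiable_onD[OF assms(2) that]
    by (auto intro!: derivative_eq_intros simp: field_simps)
qed

text \<open>This paraboloid is the building block of the barrier in the convergence proof.\<close>

lemma twice_differentiable_on_inner_self:
  fixes z :: "'e::euclidean_space"
  assumes "open U"
  shows "(\<lambda>x. k * ((x - z) \<bullet> (x - z))) twice_differentiable_on U"
    and "x \<in> U \<Longrightarrow> flat_laplacian (\<lambda>x. k * ((x - z) \<bullet> (x - z))) x = 2 * k * DIM('e)"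
proof -
  have 1: "((\<lambda>x. k * ((x - z) \<bullet> (x - z))) has_derivative (\<lambda>v. 2 * k * ((x - z) \<bullet> v))) (at x)" for x
    by (auto intro!: derivative_eq_intros simp: algebra_simps inner_commute)
  have 2: "((\<lambda>x. 2 * k * ((x - z) \<bullet> v)) has_derivative (\<lambda>w. 2 * k * (w \<bullet> v))) (at x)" for x v
    by (auto intro!: derivative_eq_intros simp: algebra_simps inner_commute)
  note I = twice_differentiable_onI[OF assms 1 2]
  show "(\<lambda>x. k * ((x - z) \<bullet> (x - z))) twice_differentiable_on U" by (rule I(1))
  show "flat_laplacian (\<lambda>x. k * ((x - z) \<bullet> (x - z))) x = 2 * k * DIM('e)" if "x \<in> U"
    unfolding flat_laplacian_def by (simp add: I(2)[OF that] inner_same_Basis)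
qed

text \<open>The second derivatives in the directions 1 and \<open>\<i>\<close> are the real parts of
  \<open>f''\<close> and of \<open>\<i> * \<i> * f''\<close>, which cancel.\<close>

lemma Re_holomorphic_harmonic:
  assumes "open U" "f holomorphic_on U"
  shows "(\<lambda>x. Re (f x)) twice_differentiable_on U"
    and "x \<in> U \<Longrightarrow> flat_laplacian (\<lambda>x. Re (f x)) x = 0"
proof -
  have *: "(g has_derivative (\<lambda>v. deriv g x * v)) (at x)" if "g holomorphic_on U" "x \<in> U" for g x
    using holomorphic_derivI[OF that(1) assms(1) that(2)] by (simp add: has_field_derivative_def)
  have 1: "((\<lambda>x. Re (f x)) has_derivative (\<lambda>v. Re (deriv f x * v))) (at x)" if "x \<in> U" for x
    by (intro bounded_linear.has_derivative[OF bounded_linear_Re] * assms that)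
  have f': "deriv f holomorphic_on U" by (intro holomorphic_deriv assms)
  have 2: "((\<lambda>x. Re (deriv f x * v)) has_derivative (\<lambda>w. Re (deriv (deriv f) x * w * v))) (at x)"
    if "x \<in> U" for x v
    by (intro bounded_linear.has_derivative[OF bounded_linear_Re] has_derivative_mult_left * f' that)
  note I = twice_differentiable_onI[OF assms(1) 1 2]
  show "(\<lambda>x. Re (f x)) twice_differentiable_on U" by (rule I(1))
  show "flat_laplacian (\<lambda>x. Re (f x)) x = 0" if "x \<in> U"
    unfolding flat_laplacian_def using that by (simp add: I(2) Basis_complex_def)
qed

section \<open>The maximum principle\<close>

text \<open>At the minimum \<open>f'\<close> vanishes. If \<open>d\<close> were negative,
  \<open>f'\<close> would be negative just to the right of 0, and the mean value theorem would
  produce a value below \<open>f 0\<close>.\<close>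

lemma second_deriv_test_local_min:
  fixes f :: "real \<Rightarrow> real"
  assumes "0 < r" and f: "\<And>s. \<bar>s\<bar> < r \<Longrightarrow> (f has_real_derivative f' s) (at s)"
    and f': "(f' has_real_derivative d) (at 0)"
    and min: "\<And>s. \<bar>s\<bar> < r \<Longrightarrow> f 0 \<le> f s"
  shows "0 \<le> d"
proof (rule ccontr)
  assume "\<not> 0 \<le> d"
  have "f' 0 = 0"
    using DERIV_local_min[OF f[of 0] \<open>0 < r\<close>] min \<open>0 < r\<close> by auto
  moreover obtain e where e: "e > 0" "\<And>s. 0 < s \<Longrightarrow> s < e \<Longrightarrow> f' s < f' 0"
    using DERIV_neg_dec_right[OF f'] \<open>\<not> 0 \<le> d\<close> by auto
  define s where "s = min e r / 2"
  have s: "0 < s" "s < e" "s < r" using e(1) \<open>0 < r\<close> by (auto simp: s_def)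
  obtain x where "0 < x" "x < s" "f s - f 0 = (s - 0) * f' x"
    using MVT2[OF s(1), of f f'] f s by auto
  moreover have "f' x < f' 0" using e(2) calculation s by auto
  ultimately have "f s < f 0" using s(1)
    by (smt (verit) mult_pos_neg)
  then show False using min[of s] s by auto
qed

text \<open>Along each coordinate line through \<open>x\<close> the one-variable test applies, so
  every summand of the Laplacian is non-negative.\<close>

lemma flat_laplacian_local_min:
  assumes U: "open U" "f twice_differentiable_on U" "x \<in> U"
    and min: "\<And>y. y \<in> U \<Longrightarrow> f x \<le> f y"
  shows "0 \<le> flat_laplacian f x"
  unfolding flat_laplacian_def
proof (rule sum_nonneg)
  fix e :: 'a assume e: "e \<in> Basis"
  obtain r where r: "r > 0" "ball x r \<subseteq> U" using U by (meson open_contains_ball)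
  have in_U: "x + s *\<^sub>R e \<in> U" if "\<bar>s\<bar> < r" for s
    using r(2) that e by (auto simp: dist_norm)
  have lin: "((\<lambda>s. x + s *\<^sub>R e) has_derivative (\<lambda>h. h *\<^sub>R e)) (at s)" for s
    by (auto intro!: derivative_eq_intros)
  show "0 \<le> second_deriv f x e e"
  proof (rule second_deriv_test_local_min[OF r(1)])
    fix s assume s: "\<bar>s\<bar> < r"
    note D = twice_differentiable_onD(1)[OF U(2) in_U[OF s]]
    have "((\<lambda>s. f (x + s *\<^sub>R e)) has_derivative
        (\<lambda>h. frechet_derivative f (at (x + s *\<^sub>R e)) (h *\<^sub>R e))) (at s)"
      using has_derivative_compose[OF lin, OF D] .
    then show "((\<lambda>s. f (x + s *\<^sub>R e)) has_real_derivative frechet_derivative f (at (x + s *\<^sub>R e)) e) (at s)"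
      unfolding has_field_derivative_def
      by (simp add: linear_scale[OF has_derivative_linear[OF D]] mult_commute_abs)
    show "f (x + 0 *\<^sub>R e) \<le> f (x + s *\<^sub>R e)" using min[OF in_U[OF s]] by simp
  next
    note D = twice_differentiable_onD(2)[OF U(2) in_U[of 0], of e]
    have "((\<lambda>s. frechet_derivative f (at (x + s *\<^sub>R e)) e) has_derivative
        (\<lambda>h. second_deriv f (x + 0 *\<^sub>R e) e (h *\<^sub>R e))) (at 0)"
      using has_derivative_compose[OF lin, OF D] r(1) by simp
    then show "((\<lambda>s. frechet_derivative f (at (x + s *\<^sub>R e)) e) has_real_derivative second_deriv f x e e) (at 0)"
      unfolding has_field_derivative_def
      using D r(1) by (simp add: linear_scale[OF has_derivative_linear] mult_commute_abs)
  qed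
qed

text \<open>The form in which the maximum principle is used below: two functions are compared where
  their difference is largest.\<close>

lemma flat_laplacian_le_at_local_max_diff:
  assumes U: "open U" "f twice_differentiable_on U" "g twice_differentiable_on U" "x \<in> U"
    and max: "\<And>y. y \<in> U \<Longrightarrow> f y - g y \<le> f x - g x"
  shows "flat_laplacian f x \<le> flat_laplacian g x"
proof -
  have "0 \<le> flat_laplacian (\<lambda>y. g y - f y) x"
    by (rule flat_laplacian_local_min[OF U(1) twice_differentiable_on_diff(1)[OF U(1,3,2)] U(4)])
      (use max in fastforce)
  then show ?thesis using twice_differentiable_on_diff(2)[OF U(1,3,2,4)] by simp
qed

section \<open>Conformally flat metrics\<close>

text \<open>Only the conformal factor varies, so each term of the Koszul formula is a multiple of a
  value of \<open>L'\<close>. The common factor \<open>exp (2 * L x)\<close> cancels, and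
  non-degeneracy of the inner product makes the vector in \<open>THE\<close> unique.\<close>

lemma christoffel_conformal:
  assumes U: "open U" "x \<in> U" and G: "\<And>y a b. y \<in> U \<Longrightarrow> G y a b = exp (2 * L y) * (a \<bullet> b)"
    and L: "(L has_derivative L') (at x)"
  shows "christoffel G x v w = L' v *\<^sub>R w + L' w *\<^sub>R v - (v \<bullet> w) *\<^sub>R (\<Sum>b\<in>Basis. L' b *\<^sub>R b)"
    (is "_ = ?u")
proof -
  interpret L': linear L' using L by (rule has_derivative_linear)
  have D: "frechet_derivative (\<lambda>y. G y a b) (at x) c = 2 * exp (2 * L x) * L' c * (a \<bullet> b)" for a b c
  proof -
    have "((\<lambda>y. exp (2 * L y) * (a \<bullet> b)) has_derivative (\<lambda>c. 2 * exp (2 * L x) * L' c * (a \<bullet> b))) (at x)"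
      using L by (auto intro!: derivative_eq_intros)
    then have *: "((\<lambda>y. G y a b) has_derivative (\<lambda>c. 2 * exp (2 * L x) * L' c * (a \<bullet> b))) (at x)"
      by (rule has_derivative_transform_within_open[OF _ U]) (simp add: G)
    show ?thesis by (simp flip: frechet_derivative_at[OF *])
  qed
  \<comment> \<open>The sum is the Euclidean gradient of \<open>L\<close>: it represents the linear
    form \<open>L'\<close>.\<close>
  have grad: "(\<Sum>b\<in>Basis. L' b *\<^sub>R b) \<bullet> z = L' z" for z
  proof -
    have "L' z = L' (\<Sum>b\<in>Basis. (z \<bullet> b) *\<^sub>R b)" by (simp add: euclidean_representation)
    also have "\<dots> = (\<Sum>b\<in>Basis. (z \<bullet> b) * L' b)" by (simp add: L'.sum L'.scale)
    finally show ?thesis by (simp add: inner_sum_left inner_commute[of z] mult.commute)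
  qed
  have koszul: "(frechet_derivative (\<lambda>y. G y w z) (at x) v +
      frechet_derivative (\<lambda>y. G y v z) (at x) w -
      frechet_derivative (\<lambda>y. G y v w) (at x) z) / 2 = exp (2 * L x) * (?u \<bullet> z)" for z
    unfolding D by (simp add: inner_add_left inner_diff_left grad field_simps)
  have eq: "G x u z = (frechet_derivative (\<lambda>y. G y w z) (at x) v +
      frechet_derivative (\<lambda>y. G y v z) (at x) w -
      frechet_derivative (\<lambda>y. G y v w) (at x) z) / 2 \<longleftrightarrow> u \<bullet> z = ?u \<bullet> z" for u z
    unfolding koszul G[OF U(2)] by simp
  show ?thesis unfolding christoffel_def eq vector_eq_rdot by simp
qed

text \<open>Conformal invariance in dimension 2: the Christoffel terms in the trace of the Hessian
  add up to \<open>2 - DIM\<close> times the gradient of \<open>L\<close>, which is zero in the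
  plane.\<close>

lemma laplacian_conformal:
  assumes U: "open U" "x \<in> U" and G: "\<And>y a b. y \<in> U \<Longrightarrow> G y a b = exp (2 * L y) * (a \<bullet> b)"
    and L: "L twice_differentiable_on U" and f: "f twice_differentiable_on U"
  shows "laplacian G f x = exp (- 2 * L x) * flat_laplacian f (x::complex)"
proof -
  define L' where "L' = frechet_derivative L (at x)"
  define f' where "f' = frechet_derivative f (at x)"
  interpret f': linear f'
    unfolding f'_def using twice_differentiable_onD(1)[OF f U(2)] by (rule has_derivative_linear)
  interpret L': linear L'
    unfolding L'_def using twice_differentiable_onD(1)[OF L U(2)] by (rule has_derivative_linear)
  define \<Gamma> where "\<Gamma> v w = L' v *\<^sub>R w + L' w *\<^sub>R v - (v \<bullet> w) *\<^sub>R (\<Sum>b\<in>Basis. L' b *\<^sub>R b)" for v w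
  have \<Gamma>: "christoffel G x v w = \<Gamma> v w" for v w
    unfolding \<Gamma>_def L'_def by (rule christoffel_conformal[OF U G twice_differentiable_onD(1)[OF L U(2)]])
  \<comment> \<open>Linearity in the direction of the first differentiation is not part of
    \<open>has_derivative\<close> for the second one. It is needed for the Hessian to be a linear
    form in \<open>w\<close>, hence representable by a vector.\<close>
  have second_deriv_linear: "linear (\<lambda>w. second_deriv f x w v)" for v
  proof
    have lin: "linear (frechet_derivative f (at y))" if "y \<in> U" for y
      using twice_differentiable_onD(1)[OF f that] by (rule has_derivative_linear)
    note D = twice_differentiable_onD(2)[OF f U(2)]
    show "second_deriv f x (a + b) v = second_deriv f x a v + second_deriv f x b v" for a b
    proof -
      have "((\<lambda>y. frechet_derivative f (at y) (a + b)) has_derivative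
          (\<lambda>v. second_deriv f x a v + second_deriv f x b v)) (at x)"
        by (rule has_derivative_transform_within_open[OF has_derivative_add[OF D D] U])
          (simp add: linear_add[OF lin])
      then show ?thesis using has_derivative_unique[OF D] by metis
    qed
    show "second_deriv f x (r *\<^sub>R a) v = r *\<^sub>R second_deriv f x a v" for r a
    proof -
      have "((\<lambda>y. frechet_derivative f (at y) (r *\<^sub>R a)) has_derivative
          (\<lambda>v. r *\<^sub>R second_deriv f x a v)) (at x)"
        by (rule has_derivative_transform_within_open[OF has_derivative_scaleR_right[OF D] U])
          (simp add: linear_scale[OF lin])
      then show ?thesis using has_derivative_unique[OF D] by metis
    qed
  qed
  \<comment> \<open>The arguments are swapped because \<open>hessian\<close> differentiates along
    \<open>w\<close> first and then along \<open>v\<close>, while \<open>second_deriv\<close> lists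
    the first direction first.\<close>
  define H where "H v w = second_deriv f x w v - f' (\<Gamma> v w)" for v w
  have hess: "hessian G f x v w = H v w" for v w
    unfolding hessian_def H_def \<Gamma> second_deriv_def f'_def ..
  have "linear (\<lambda>w. f' (\<Gamma> v w))" for v
    by standard (auto simp: \<Gamma>_def f'.add f'.diff f'.scale L'.add L'.scale inner_add_right algebra_simps)
  then have H_linear: "linear (H v)" for v
    unfolding H_def by (intro linear_compose_sub second_deriv_linear)
  have H_inner: "(\<Sum>b\<in>Basis. H v b *\<^sub>R b) \<bullet> w = H v w" for v w
  proof -
    have "H v w = H v (\<Sum>b\<in>Basis. (w \<bullet> b) *\<^sub>R b)" by (simp add: euclidean_representation)
    also have "\<dots> = (\<Sum>b\<in>Basis. (w \<bullet> b) * H v b)"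
      by (simp add: linear_sum[OF H_linear] linear_scale[OF H_linear])
    finally show ?thesis by (simp add: inner_sum_left inner_commute[of w] mult.commute)
  qed
  have "(THE u. \<forall>w. G x u w = hessian G f x v w) = exp (- 2 * L x) *\<^sub>R (\<Sum>b\<in>Basis. H v b *\<^sub>R b)" for v
  proof -
    have eq: "G x u w = hessian G f x v w \<longleftrightarrow> u \<bullet> w = (exp (- 2 * L x) *\<^sub>R (\<Sum>b\<in>Basis. H v b *\<^sub>R b)) \<bullet> w" for u w
      unfolding hess G[OF U(2)] inner_scaleR_left H_inner
      by (simp add: exp_minus field_simps)
    show ?thesis unfolding eq vector_eq_rdot by simp
  qed
  then have "laplacian G f x = exp (- 2 * L x) * (\<Sum>e\<in>Basis. H e e)"
    unfolding laplacian_def endo_trace_def by (simp add: H_inner sum_distrib_left)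
  also have "(\<Sum>e\<in>Basis. H e e) = flat_laplacian f x - f' (\<Sum>e\<in>Basis. \<Gamma> e e)"
    by (simp add: H_def flat_laplacian_def sum_subtractf f'.sum)
  also have "(\<Sum>e\<in>Basis. \<Gamma> e e) = 0"
    by (simp add: \<Gamma>_def Basis_complex_def algebra_simps)
  finally show ?thesis by simp
qed

text \<open>This is the formula \<open>K = - exp (- 2 * L) * flat_laplacian L\<close>, multiplied by
  the squared area \<open>exp (4 * L)\<close> of the frame \<open>1, \<i>\<close>.\<close>

lemma curvature_conformal:
  assumes U: "open U" "x \<in> U" and G: "\<And>y a b. y \<in> U \<Longrightarrow> G y a b = exp (2 * L y) * (a \<bullet> b)"
    and L: "L twice_differentiable_on U"
  shows "G x (riemann_curvature G x 1 \<i> \<i>) 1 = - exp (2 * L x) * flat_laplacian L (x::complex)"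
proof -
  define \<Gamma> where "\<Gamma> P v w = P v *\<^sub>R w + P w *\<^sub>R v - (v \<bullet> w) *\<^sub>R (\<Sum>b\<in>Basis. P b *\<^sub>R b)"
    for P :: "complex \<Rightarrow> real" and v w
  have \<Gamma>: "christoffel G y v w = \<Gamma> (frechet_derivative L (at y)) v w" if "y \<in> U" for y v w
    unfolding \<Gamma>_def by (rule christoffel_conformal[OF U(1) that G twice_differentiable_onD(1)[OF L that]])
  have D: "frechet_derivative (\<lambda>y. christoffel G y v w) (at x) a = \<Gamma> (\<lambda>b. second_deriv L x b a) v w" for v w a
  proof -
    have "((\<lambda>y. \<Gamma> (frechet_derivative L (at y)) v w) has_derivative
        (\<lambda>a. \<Gamma> (\<lambda>b. second_deriv L x b a) v w)) (at x)"
      unfolding \<Gamma>_def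
      by (intro has_derivative_add has_derivative_diff has_derivative_scaleR_left
          has_derivative_scaleR_right has_derivative_sum twice_differentiable_onD(2)[OF L U(2)])
    then have *: "((\<lambda>y. christoffel G y v w) has_derivative
        (\<lambda>a. \<Gamma> (\<lambda>b. second_deriv L x b a) v w)) (at x)"
      by (rule has_derivative_transform_within_open[OF _ U]) (simp add: \<Gamma>)
    show ?thesis by (simp flip: frechet_derivative_at[OF *])
  qed
  interpret L': linear "frechet_derivative L (at x)"
    using twice_differentiable_onD(1)[OF L U(2)] by (rule has_derivative_linear)
  define p q where "p = frechet_derivative L (at x) 1" and "q = frechet_derivative L (at x) \<i>"
  have L': "frechet_derivative L (at x) v = Re v * p + Im v * q" for v
  proof -
    have "v = Re v *\<^sub>R 1 + Im v *\<^sub>R \<i>" by (simp add: complex_eq_iff)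
    then show ?thesis unfolding p_def q_def by (metis L'.add L'.scale real_scaleR_def)
  qed
  \<comment> \<open>Both products of Christoffel terms have real part
    \<open>q\<^sup>2 - p\<^sup>2\<close>, so they cancel and only the second derivatives of
    \<open>L\<close> remain.\<close>
  have "Re (riemann_curvature G x 1 \<i> \<i>) = - flat_laplacian L x"
    unfolding riemann_curvature_def D \<Gamma>[OF U(2)]
    by (simp add: \<Gamma>_def L' Basis_complex_def flat_laplacian_def inner_complex_def algebra_simps)
  then show ?thesis by (simp add: G[OF U(2)] inner_complex_def)
qed

section \<open>Local logarithms, charts and maxima on compact manifolds\<close>

text \<open>A small disc avoiding the zeros of \<open>f\<close> is contractible, so \<open>f\<close>
  has a logarithm \<open>g\<close> there. This exhibits \<open>ln |f|\<close> as the harmonic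
  function \<open>Re g\<close>.\<close>

lemma holomorphic_local_log:
  assumes "open U" "f holomorphic_on U" "z \<in> U" "f z \<noteq> 0"
  obtains V g where "open V" "z \<in> V" "V \<subseteq> U" "g holomorphic_on V"
    "\<And>x. x \<in> V \<Longrightarrow> f x = exp (g x)"
proof -
  have "continuous_on U f" using assms(2) by (rule holomorphic_on_imp_continuous_on)
  then have "open {x \<in> U. f x \<noteq> 0}"
    using continuous_open_preimage[of U f "- {0}"] assms(1) by (simp add: vimage_def Int_def conj_commute open_Compl)
  then obtain r where r: "r > 0" "ball z r \<subseteq> {x \<in> U. f x \<noteq> 0}"
    using assms(3,4) open_contains_ball by blast
  have "f holomorphic_on ball z r" using assms(2) r(2) holomorphic_on_subset by blast
  then obtain g where "g holomorphic_on ball z r" "\<And>x. x \<in> ball z r \<Longrightarrow> f x = exp (g x)"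
    using contractible_imp_holomorphic_log[of f "ball z r"] r(2)
    by (metis (mono_tags, lifting) convex_ball convex_imp_contractible mem_Collect_eq subsetD)
  then show thesis using that[of "ball z r" g] r by auto
qed

lemma chart_facts:
  assumes "smooth_manifold X" "c \<in> atlas X"
  shows "openin (mtop X) (cdom c)" "open (cimg c)" "inj_on (cmap c) (cdom c)"
    and "homeomorphic_map (subtopology (mtop X) (cdom c)) (top_of_set (cimg c)) (cmap c)"
    and "cdom c \<subseteq> topspace (mtop X)"
proof -
  show *: "openin (mtop X) (cdom c)" and "open (cimg c)"
    and hom: "homeomorphic_map (subtopology (mtop X) (cdom c)) (top_of_set (cimg c)) (cmap c)"
    using assms unfolding smooth_manifold_def by auto
  show sub: "cdom c \<subseteq> topspace (mtop X)" using * openin_subset by blast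
  show "inj_on (cmap c) (cdom c)"
    using homeomorphic_imp_injective_map[OF hom] sub by (simp add: Int_absorb1)
qed

text \<open>Supplies the maxima to which the maximum principle is applied: continuity is checked in
  coordinates and pasted along the open cover by chart domains.\<close>

lemma chartwise_continuous_attains_max:
  assumes X: "smooth_manifold X" "compact_space (mtop X)" "topspace (mtop X) \<noteq> {}"
    and C: "C \<subseteq> atlas X" "(\<Union>c\<in>C. cdom c) = topspace (mtop X)"
    and F: "\<And>c. c \<in> C \<Longrightarrow> continuous_on (cimg c) (F \<circ> cinv c)"
  obtains p where "p \<in> topspace (mtop X)" "\<And>x. x \<in> topspace (mtop X) \<Longrightarrow> F x \<le> (F p :: real)"
proof -
  have "continuous_map (mtop X) euclideanreal F"
  proof (rule pasting_lemma[where T = cdom and f = "\<lambda>_. F" and I = C])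
    fix c assume c: "c \<in> C"
    then have c': "c \<in> atlas X" using C by auto
    note chart = chart_facts[OF X(1) c']
    show "openin (mtop X) (cdom c)" by (rule chart(1))
    have "continuous_map (subtopology (mtop X) (cdom c)) (top_of_set (cimg c)) (cmap c)"
      using chart(4) by (rule homeomorphic_imp_continuous_map)
    moreover have "continuous_map (top_of_set (cimg c)) euclideanreal (F \<circ> cinv c)"
      using F[OF c] by simp
    ultimately have "continuous_map (subtopology (mtop X) (cdom c)) euclideanreal (F \<circ> cinv c \<circ> cmap c)"
      by (rule continuous_map_compose)
    then show "continuous_map (subtopology (mtop X) (cdom c)) euclideanreal F"
      by (rule continuous_map_eq) (use chart(3) in auto)
  qed (use C(2) in blast)+
  then have "compactin euclideanreal (F ` topspace (mtop X))"
    using X(2) image_compactin compact_space_def by metis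
  then have "compact (F ` topspace (mtop X))" by simp
  then show thesis
    using compact_attains_sup[of "F ` topspace (mtop X)"] X(3) that by auto
qed

section \<open>The hyperbolic metric in conformal charts\<close>

text \<open>For a metric \<open>exp (2 * L)\<close> times the Euclidean one, curvature -1 is the
  Liouville equation: the Laplacian of \<open>L\<close> equals \<open>exp (2 * L)\<close>.\<close>

lemma hyperbolic_conformal_chart:
  assumes S: "smooth_manifold S" "hyperbolic_metric S h" "compatible_complex_structure S h C" "c \<in> C"
  shows "(\<lambda>z. ln (h c z 1 1) / 2) twice_differentiable_on cimg c"
    and "z \<in> cimg c \<Longrightarrow> 0 < h c z 1 1"
    and "z \<in> cimg c \<Longrightarrow> h c z a b = h c z 1 1 * (a \<bullet> b)"
    and "z \<in> cimg c \<Longrightarrow> flat_laplacian (\<lambda>z. ln (h c z 1 1) / 2) z = h c z 1 1"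
proof -
  have c: "c \<in> atlas S" using S unfolding compatible_complex_structure_def by auto
  have U: "open (cimg c)" using chart_facts(2)[OF S(1) c] .
  have "\<exists>v. \<forall>a b. h c z a b = exp (2 * v) * (a \<bullet> b)" if "z \<in> cimg c" for z
    using S(3,4) that unfolding compatible_complex_structure_def by blast
  \<comment> \<open>The exponents chosen point by point carry no regularity, so \<open>v\<close> is
    replaced by half the logarithm of \<open>h c z 1 1\<close>, which is smooth because
    \<open>h\<close> is.\<close>
  then obtain v where v: "\<And>z a b. z \<in> cimg c \<Longrightarrow> h c z a b = exp (2 * v z) * (a \<bullet> b)"
    by metis
  have one: "(1::complex) \<bullet> 1 = 1" by (simp add: inner_complex_def)
  show pos: "0 < h c z 1 1" if "z \<in> cimg c" for z using v[OF that] one by simp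
  show conf: "h c z a b = h c z 1 1 * (a \<bullet> b)" if "z \<in> cimg c" for z a b
    using v[OF that] one by simp
  have "smooth_on (cimg c) (\<lambda>z. h c z 1 1)"
    using S(2) c unfolding hyperbolic_metric_def riemannian_def sym_tensor_def by blast
  then show L: "(\<lambda>z. ln (h c z 1 1) / 2) twice_differentiable_on cimg c"
    using twice_differentiable_on_half_ln[OF U smooth_on_imp_twice_differentiable_on] pos by blast
  show "flat_laplacian (\<lambda>z. ln (h c z 1 1) / 2) z = h c z 1 1" if z: "z \<in> cimg c"
  proof -
    have E: "exp (2 * (ln (h c y 1 1) / 2)) = h c y 1 1" if "y \<in> cimg c" for y
      using pos[OF that] by simp
    have curv: "h c z (riemann_curvature (h c) z 1 \<i> \<i>) 1
        = - h c z 1 1 * flat_laplacian (\<lambda>z. ln (h c z 1 1) / 2) z"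
      using curvature_conformal[OF U z _ L, of "h c"] E conf z by metis
    \<comment> \<open>The area term is a positive square, so the curvature hypothesis does apply to
      the pair \<open>1, \<i>\<close>.\<close>
    have Q: "h c z 1 1 * h c z \<i> \<i> - (h c z 1 \<i>)\<^sup>2 = (h c z 1 1)\<^sup>2"
      using conf[OF z, of \<i> \<i>] conf[OF z, of 1 \<i>] by (simp add: inner_complex_def power2_eq_square)
    have "h c z (riemann_curvature (h c) z 1 \<i> \<i>) 1 / (h c z 1 1)\<^sup>2 = - 1"
      using S(2) c z pos[OF z] unfolding hyperbolic_metric_def constant_sectional_curvature_def Let_def
      by (metis Q less_irrefl zero_eq_power2)
    then show ?thesis unfolding curv using pos[OF z] by (simp add: field_simps power2_eq_square)
  qed
qed

text \<open>\<open>I / t\<close> reads \<open>exp (2 * log_factor h u t c z)\<close> times the Euclidean metric in a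
  conformal chart.\<close>

definition log_factor ::
  "('a, complex) tensor2 \<Rightarrow> ('a \<Rightarrow> real) \<Rightarrow> real \<Rightarrow> ('a, complex) chart \<Rightarrow> complex \<Rightarrow> real" where
  "log_factor h u t c z = u (cinv c z) + ln (h c z 1 1) / 2 - ln t / 2"

section \<open>Comparison on the closed surface\<close>

context
  fixes S :: "('a, complex) mfd" and h :: "('a, complex) tensor2"
    and C :: "('a, complex) chart set" and q :: "'a quad_diff"
  assumes S: "closed_oriented_surface S" and h: "hyperbolic_metric S h"
    and C: "compatible_complex_structure S h C" and q: "holomorphic_quad_diff C q"
begin

lemma S_manifold: "smooth_manifold S" "compact_space (mtop S)"
  using S unfolding closed_oriented_surface_def by auto

lemma C_atlas: "C \<subseteq> atlas S" "(\<Union>c\<in>C. cdom c) = topspace (mtop S)"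
  using C unfolding compatible_complex_structure_def by auto

lemma chart_C:
  assumes "c \<in> C"
  shows "open (cimg c)" and "p \<in> cdom c \<Longrightarrow> cinv c (cmap c p) = p"
    and "z \<in> cimg c \<Longrightarrow> cinv c z \<in> topspace (mtop S)"
  using chart_facts[OF S_manifold(1) subsetD[OF C_atlas(1) assms]] inv_into_into[of z "cmap c" "cdom c"]
  by auto

lemmas h_chart = hyperbolic_conformal_chart[OF S_manifold(1) h C]

lemma exp_log_factor:
  assumes "c \<in> C" "z \<in> cimg c" "t > 0"
  shows "exp (2 * log_factor h u t c z) = exp (2 * u (cinv c z)) * h c z 1 1 / t"
  using h_chart(2)[OF assms(1,2)] assms(3)
  by (simp add: log_factor_def exp_add exp_diff ring_distribs)

lemma conformal_metric_log_factor:
  assumes "c \<in> C" "z \<in> cimg c" "t > 0"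
  shows "conformal_metric u h c z v w / t = exp (2 * log_factor h u t c z) * (v \<bullet> w)"
  unfolding exp_log_factor[OF assms] conformal_metric_def h_chart(3)[OF assms(1,2), of v w] by simp

text \<open>By conformal invariance the flat Laplacian of \<open>u\<close> is
  \<open>h c z 1 1\<close> times the right-hand side of the Gauss equation. The Laplacian of
  \<open>ln (h c z 1 1) / 2\<close> then cancels the term -1, and \<open>ln t / 2\<close> is
  constant in \<open>z\<close>.\<close>

lemma gauss_equation_chart:
  assumes u: "gauss_equation_sol S h C (\<lambda>c z. of_real t * q c z) u" and "t > 0" "c \<in> C"
  shows "log_factor h u t c twice_differentiable_on cimg c"
    and "z \<in> cimg c \<Longrightarrow> flat_laplacian (log_factor h u t c) z =
      t * (exp (2 * log_factor h u t c z) - exp (- 2 * log_factor h u t c z) * (cmod (q c z))\<^sup>2)"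
proof -
  note U = chart_C(1)[OF \<open>c \<in> C\<close>]
  have "c \<in> atlas S" using C_atlas \<open>c \<in> C\<close> by auto
  then have "smooth_on (cimg c) (u \<circ> cinv c)"
    using u unfolding gauss_equation_sol_def smooth_function_def by auto
  then have u2: "(u \<circ> cinv c) twice_differentiable_on cimg c"
    by (rule smooth_on_imp_twice_differentiable_on)
  note L = h_chart(1)[OF \<open>c \<in> C\<close>]
  note A = twice_differentiable_on_add[OF U u2 L]
  note B = twice_differentiable_on_diff[OF U A(1) twice_differentiable_on_const(1)[OF U]]
  have eq: "log_factor h u t c = (\<lambda>z. (u \<circ> cinv c) z + ln (h c z 1 1) / 2 - ln t / 2)"
    by (simp add: log_factor_def fun_eq_iff)
  show "log_factor h u t c twice_differentiable_on cimg c" unfolding eq by (rule B(1))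
  assume z: "z \<in> cimg c"
  note E = h_chart(2)[OF \<open>c \<in> C\<close> z]
  have "h c y a b = exp (2 * (ln (h c y 1 1) / 2)) * (a \<bullet> b)" if "y \<in> cimg c" for y a b
    using h_chart(2)[OF \<open>c \<in> C\<close> that] h_chart(3)[OF \<open>c \<in> C\<close> that, of a b] by simp
  from laplacian_conformal[OF U z this L u2]
  have "flat_laplacian (u \<circ> cinv c) z = h c z 1 1 * laplacian (h c) (u \<circ> cinv c) z"
    using E by (simp add: exp_minus)
  also have "laplacian (h c) (u \<circ> cinv c) z =
      exp (2 * u (cinv c z)) - exp (- 2 * u (cinv c z)) * (t * cmod (q c z) / h c z 1 1)\<^sup>2 - 1"
    using u \<open>c \<in> C\<close> z \<open>t > 0\<close> chart_C(2)[OF \<open>c \<in> C\<close>]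
    unfolding gauss_equation_sol_def quad_norm_def by (auto simp: norm_mult)
  finally have lap: "flat_laplacian (log_factor h u t c) z =
      h c z 1 1 * (exp (2 * u (cinv c z)) - exp (- 2 * u (cinv c z)) * (t * cmod (q c z) / h c z 1 1)\<^sup>2)"
    unfolding eq B(2)[OF z] A(2)[OF z] twice_differentiable_on_const(2)[OF U z]
      h_chart(4)[OF \<open>c \<in> C\<close> z] by (simp add: right_diff_distrib comp_def)
  have "exp (- 2 * log_factor h u t c z) = exp (- 2 * u (cinv c z)) * t / h c z 1 1"
    using exp_log_factor[OF \<open>c \<in> C\<close> z \<open>t > 0\<close>, of u] by (simp add: exp_minus field_simps)
  then show "flat_laplacian (log_factor h u t c) z =
      t * (exp (2 * log_factor h u t c z) - exp (- 2 * log_factor h u t c z) * (cmod (q c z))\<^sup>2)"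
    unfolding exp_log_factor[OF \<open>c \<in> C\<close> z \<open>t > 0\<close>] lap
    using E \<open>t > 0\<close> by (simp only:) (simp add: field_simps power2_eq_square)
qed

text \<open>Under a change of chart with derivative \<open>D\<close>, both
  \<open>cmod (q c z)\<close> and \<open>h c z 1 1\<close> are multiplied by the square of
  \<open>cmod D\<close>. So the norm is a function on \<open>S\<close>, whose maximum can be sought
  globally.\<close>

lemma quad_norm_chart_independent:
  assumes c: "c \<in> C" "p \<in> cdom c" and d: "d \<in> C" "p \<in> cdom d"
  shows "quad_norm h q c (cmap c p) = quad_norm h q d (cmap d p)"
proof -
  define z where "z = cmap c p"
  define D where "D = deriv (loc c d id) z"
  have z: "z \<in> locdom c d id" "z \<in> cimg c" using c d by (auto simp: z_def locdom_def)
  have loc: "loc c d id z = cmap d p" using chart_C(2)[OF c] by (simp add: loc_def z_def)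
  have at: "c \<in> atlas S" "d \<in> atlas S" using C_atlas c d by auto
  note cc = chart_facts[OF S_manifold(1) at(1)] and dd = chart_facts[OF S_manifold(1) at(2)]
  have "openin (subtopology (mtop S) (cdom c)) (cdom c \<inter> cdom d)"
    using dd(1) by (auto simp: openin_subtopology)
  then have "openin (top_of_set (cimg c)) (cmap c ` (cdom c \<inter> cdom d))"
    using homeomorphic_imp_open_map[OF cc(4)] unfolding open_map_def by blast
  then have opn: "open (locdom c d id)"
    using cc(2) by (auto simp: locdom_def dest: openin_open_trans)
  have "loc c d id holomorphic_on locdom c d id"
    using C c d unfolding compatible_complex_structure_def by blast
  then have der: "(loc c d id has_derivative (*) D) (at z)"
    using holomorphic_derivI[OF _ opn z(1)] unfolding has_field_derivative_def D_def by blast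
  have "h c z 1 1 = h d (loc c d id z) (loc_deriv c d id z 1) (loc_deriv c d id z 1)"
    using h at z(1) unfolding hyperbolic_metric_def riemannian_def sym_tensor_def by blast
  then have hc: "h c z 1 1 = h d (cmap d p) 1 1 * (cmod D)\<^sup>2"
    using h_chart(3)[OF d(1), of "cmap d p" D D] d(2)
    by (simp add: loc power2_norm_eq_inner flip: frechet_derivative_at[OF der])
  have qc: "q c z = q d (cmap d p) * D\<^sup>2"
    using q c d z(1) loc unfolding holomorphic_quad_diff_def D_def by metis
  \<comment> \<open>Positivity of \<open>h\<close> in the chart \<open>c\<close> excludes
    \<open>D = 0\<close>.\<close>
  have "D \<noteq> 0" using hc h_chart(2)[OF c(1) z(2)] by auto
  then show ?thesis unfolding quad_norm_def z_def[symmetric] hc qc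
    by (simp add: norm_mult norm_power)
qed

text \<open>Where the ratio of the flat metric to \<open>I / t\<close> is maximal and positive, half
  of \<open>ln |q|\<close> minus the log factor is maximal too. The first function being harmonic,
  the log factor has non-negative Laplacian there, and its equation says that the ratio is at most
  1.\<close>

lemma metric_ge_flat_metric:
  assumes u: "gauss_equation_sol S h C (\<lambda>c z. of_real t * q c z) u" and "t > 0" "c \<in> C" "z \<in> cimg c"
  shows "cmod (q c z) \<le> exp (2 * log_factor h u t c z)"
proof -
  \<comment> \<open>An arbitrary chart of \<open>C\<close> around \<open>p\<close> is chosen; by
    chart independence the choice is harmless.\<close>
  define N where "N p = (let c = (SOME c. c \<in> C \<and> p \<in> cdom c) in quad_norm h q c (cmap c p))" for p
  have N: "N p = quad_norm h q c (cmap c p)" if "c \<in> C" "p \<in> cdom c" for c p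
  proof -
    have "(SOME c. c \<in> C \<and> p \<in> cdom c) \<in> C \<and> p \<in> cdom (SOME c. c \<in> C \<and> p \<in> cdom c)"
      using that by (intro someI[of "\<lambda>c. c \<in> C \<and> p \<in> cdom c"]) auto
    then show ?thesis unfolding N_def Let_def using quad_norm_chart_independent that by blast
  qed
  define F where "F p = t * exp (- 2 * u p) * N p" for p
  have F: "F (cinv c z) = exp (- 2 * log_factor h u t c z) * cmod (q c z)"
    if "c \<in> C" "z \<in> cimg c" for c z
  proof -
    have "N (cinv c z) = cmod (q c z) / h c z 1 1"
      using N[OF that(1), of "cinv c z"] that(2) chart_C(2)[OF that(1)] by (auto simp: quad_norm_def)
    moreover have "exp (- 2 * log_factor h u t c z) = exp (- 2 * u (cinv c z)) * t / h c z 1 1"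
      using exp_log_factor[OF that \<open>t > 0\<close>, of u] by (simp add: exp_minus field_simps)
    ultimately show ?thesis unfolding F_def by simp
  qed
  have "cinv c z \<in> topspace (mtop S)"
    using chart_C(3)[OF \<open>c \<in> C\<close> \<open>z \<in> cimg c\<close>] .
  moreover have "continuous_on (cimg c) (F \<circ> cinv c)" if "c \<in> C" for c
  proof -
    have "continuous_on (cimg c) (q c)"
      using q that unfolding holomorphic_quad_diff_def by (blast intro: holomorphic_on_imp_continuous_on)
    moreover have "continuous_on (cimg c) (log_factor h u t c)"
      by (rule twice_differentiable_imp_continuous_on[OF gauss_equation_chart(1)[OF u \<open>t > 0\<close> that]])
    ultimately have "continuous_on (cimg c) (\<lambda>z. exp (- 2 * log_factor h u t c z) * cmod (q c z))"
      by (intro continuous_intros)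
    then show ?thesis by (rule continuous_on_eq) (simp add: F that)
  qed
  ultimately obtain p where p: "p \<in> topspace (mtop S)" "\<And>x. x \<in> topspace (mtop S) \<Longrightarrow> F x \<le> F p"
    using chartwise_continuous_attains_max[OF S_manifold _ C_atlas] by blast
  have "F p \<le> 1"
  proof (cases "F p \<le> 0")
    case False
    obtain d where d: "d \<in> C" "p \<in> cdom d" using p(1) C_atlas(2) by blast
    define \<zeta> where "\<zeta> = cmap d p"
    have \<zeta>: "\<zeta> \<in> cimg d" "cinv d \<zeta> = p" using d chart_C(2)[OF d] by (auto simp: \<zeta>_def)
    \<comment> \<open>Positivity of \<open>F p\<close> keeps the maximum away from the zeros of
      \<open>q\<close>, so a local logarithm is available.\<close>
    have "q d \<zeta> \<noteq> 0" using False F[OF d(1) \<zeta>(1)] \<zeta>(2) by auto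
    moreover have "q d holomorphic_on cimg d" using q d(1) unfolding holomorphic_quad_diff_def by blast
    ultimately obtain V g where V: "open V" "\<zeta> \<in> V" "V \<subseteq> cimg d" and g: "g holomorphic_on V"
      "\<And>x. x \<in> V \<Longrightarrow> q d x = exp (g x)"
      using holomorphic_local_log[OF chart_C(1)[OF d(1)]] \<zeta>(1) by metis
    \<comment> \<open>Since \<open>exp\<close> is increasing, a maximum of \<open>F\<close> is a
      maximum of the exponent, which is a harmonic function minus the log factor.\<close>
    have F_V: "F (cinv d x) = exp (2 * (Re (g x / 2) - log_factor h u t d x))" if "x \<in> V" for x
    proof -
      have "exp (2 * (Re (g x / 2) - log_factor h u t d x)) = exp (- 2 * log_factor h u t d x) * exp (Re (g x))"
        by (simp add: flip: exp_add)
      then show ?thesis using F[OF d(1)] V(3) that g(2)[OF that] by auto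
    qed
    have g2: "(\<lambda>x. g x / 2) holomorphic_on V" using g(1) by (intro holomorphic_intros) auto
    note Re_g = Re_holomorphic_harmonic[OF V(1) g2]
    have "flat_laplacian (\<lambda>x. Re (g x / 2)) \<zeta> \<le> flat_laplacian (log_factor h u t d) \<zeta>"
    proof (rule flat_laplacian_le_at_local_max_diff[OF V(1) Re_g(1) _ V(2)])
      show "log_factor h u t d twice_differentiable_on V"
        by (rule twice_differentiable_on_subset[OF gauss_equation_chart(1)[OF u \<open>t > 0\<close> d(1)] V(3)])
      fix y assume y: "y \<in> V"
      then have "cinv d y \<in> topspace (mtop S)" using chart_C(3)[OF d(1)] V(3) by blast
      then have "F (cinv d y) \<le> F (cinv d \<zeta>)" using p(2) \<zeta>(2) by simp
      then show "Re (g y / 2) - log_factor h u t d y \<le> Re (g \<zeta> / 2) - log_factor h u t d \<zeta>"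
        unfolding F_V[OF y] F_V[OF V(2)] by simp
    qed
    then have "0 \<le> exp (2 * log_factor h u t d \<zeta>) - exp (- 2 * log_factor h u t d \<zeta>) * (cmod (q d \<zeta>))\<^sup>2"
      unfolding Re_g(2)[OF V(2)] gauss_equation_chart(2)[OF u \<open>t > 0\<close> d(1) \<zeta>(1)]
      using \<open>t > 0\<close> by (simp add: zero_le_mult_iff)
    then have "(exp (- 2 * log_factor h u t d \<zeta>) * cmod (q d \<zeta>))\<^sup>2 \<le> 1"
      by (simp add: exp_minus field_simps power2_eq_square)
    then have "exp (- 2 * log_factor h u t d \<zeta>) * cmod (q d \<zeta>) \<le> 1"
      by (metis power2_le_imp_le one_power2 zero_le_one)
    then show ?thesis using F[OF d(1) \<zeta>(1)] \<zeta>(2) by simp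
  qed simp
  then have "F (cinv c z) \<le> 1" using p(2) \<open>cinv c z \<in> topspace (mtop S)\<close> by fastforce
  then show ?thesis unfolding F[OF assms(3,4)] by (simp add: exp_minus field_simps)
qed

text \<open>Put \<open>R x = exp (2 * x) - exp (- 2 * x) * k\<^sup>2\<close>, which is strictly
  increasing. Where the difference of the log factors is largest,
  \<open>t * R a \<le> s * R b\<close>; as \<open>R b\<close> is non-negative by the lower bound,
  this is at most \<open>t * R b\<close>, whence \<open>a \<le> b\<close>.\<close>

lemma log_factor_antimono:
  assumes us: "gauss_equation_sol S h C (\<lambda>c z. of_real s * q c z) us" and "s > 0"
    and ut: "gauss_equation_sol S h C (\<lambda>c z. of_real t * q c z) ut" and "s \<le> t"
    and "c \<in> C" "z \<in> cimg c"
  shows "log_factor h ut t c z \<le> log_factor h us s c z"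
proof -
  have "t > 0" using assms by simp
  \<comment> \<open>The terms \<open>ln (h c z 1 1) / 2\<close> cancel in the difference of the log
    factors, which leaves a function on \<open>S\<close>.\<close>
  define F where "F p = ut p - us p - (ln t - ln s) / 2" for p
  have F: "F (cinv c z) = log_factor h ut t c z - log_factor h us s c z" for c z
    by (simp add: F_def log_factor_def field_simps)
  have "continuous_on (cimg c) (F \<circ> cinv c)" if "c \<in> C" for c
    unfolding comp_def F
    by (intro continuous_intros twice_differentiable_imp_continuous_on gauss_equation_chart(1) that
        us ut \<open>s > 0\<close> \<open>t > 0\<close>)
  then obtain p where p: "p \<in> topspace (mtop S)" "\<And>x. x \<in> topspace (mtop S) \<Longrightarrow> F x \<le> F p"
    using chartwise_continuous_attains_max[OF S_manifold _ C_atlas] chart_C(3)[OF assms(5,6)] by blast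
  obtain d where d: "d \<in> C" "p \<in> cdom d" using p(1) C_atlas(2) by blast
  define \<zeta> where "\<zeta> = cmap d p"
  have \<zeta>: "\<zeta> \<in> cimg d" "cinv d \<zeta> = p" using d chart_C(2)[OF d] by (auto simp: \<zeta>_def)
  define a b k where "a = log_factor h ut t d \<zeta>" "b = log_factor h us s d \<zeta>" "k = cmod (q d \<zeta>)"
  note abk = this
  have "flat_laplacian (log_factor h ut t d) \<zeta> \<le> flat_laplacian (log_factor h us s d) \<zeta>"
    by (rule flat_laplacian_le_at_local_max_diff[OF chart_C(1)[OF d(1)]
          gauss_equation_chart(1)[OF ut \<open>t > 0\<close> d(1)] gauss_equation_chart(1)[OF us \<open>s > 0\<close> d(1)] \<zeta>(1)])
      (metis F p(2) \<zeta>(2) chart_C(3)[OF d(1)])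
  then have le: "t * (exp (2 * a) - exp (- 2 * a) * k\<^sup>2) \<le> s * (exp (2 * b) - exp (- 2 * b) * k\<^sup>2)"
    unfolding gauss_equation_chart(2)[OF ut \<open>t > 0\<close> d(1) \<zeta>(1)]
      gauss_equation_chart(2)[OF us \<open>s > 0\<close> d(1) \<zeta>(1)] abk .
  have "k \<le> exp (2 * b)"
    using metric_ge_flat_metric[OF us \<open>s > 0\<close> d(1) \<zeta>(1)] by (simp add: abk)
  then have "k\<^sup>2 \<le> exp (2 * b) * exp (2 * b)"
    unfolding power2_eq_square by (intro mult_mono) (auto simp: abk)
  then have nonneg: "0 \<le> exp (2 * b) - exp (- 2 * b) * k\<^sup>2"
    by (simp add: exp_minus field_simps)
  have "a \<le> b"
  proof (rule ccontr)
    assume "\<not> a \<le> b"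
    then have "exp (2 * b) < exp (2 * a)" "exp (- 2 * a) * k\<^sup>2 \<le> exp (- 2 * b) * k\<^sup>2"
      by (auto intro!: mult_right_mono)
    then have "t * (exp (2 * b) - exp (- 2 * b) * k\<^sup>2) < t * (exp (2 * a) - exp (- 2 * a) * k\<^sup>2)"
      using \<open>t > 0\<close> by (intro mult_strict_left_mono less_le_trans[OF diff_strict_right_mono diff_left_mono]) auto
    moreover have "s * (exp (2 * b) - exp (- 2 * b) * k\<^sup>2) \<le> t * (exp (2 * b) - exp (- 2 * b) * k\<^sup>2)"
      using nonneg \<open>s \<le> t\<close> by (rule mult_right_mono[rotated])
    ultimately show False using le by simp
  qed
  then have "F p \<le> 0" using F[of d \<zeta>] \<zeta>(2) by (simp add: abk)
  then have "F (cinv c z) \<le> 0" using p(2) chart_C(3)[OF assms(5,6)] by fastforce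
  then show ?thesis unfolding F by simp
qed

end

section \<open>Convergence away from the zeros\<close>

text \<open>A local statement in one chart. The excess \<open>\<psi> t\<close> of
  \<open>\<Phi> t\<close> over half of \<open>ln |f|\<close> satisfies an equation whose right-hand
  side is \<open>2 * t * cmod (f x) * sinh (2 * \<psi> t x)\<close>. For large \<open>t\<close> this
  strong absorption forces a bounded non-negative solution to be small inside a disc where
  \<open>f\<close> has no zero.\<close>

lemma tendsto_of_laplacian_equation:
  assumes U: "open U" "z \<in> U" and f: "f holomorphic_on U" "f z \<noteq> 0"
    and \<Phi>: "\<And>t. t > 0 \<Longrightarrow> \<Phi> t twice_differentiable_on U"
    and eq: "\<And>t x. t > 0 \<Longrightarrow> x \<in> U \<Longrightarrow>
      flat_laplacian (\<Phi> t) x = t * (exp (2 * \<Phi> t x) - exp (- 2 * \<Phi> t x) * (cmod (f x))\<^sup>2)"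
    and lower: "\<And>t x. t > 0 \<Longrightarrow> x \<in> U \<Longrightarrow> cmod (f x) \<le> exp (2 * \<Phi> t x)"
    and anti: "\<And>s t x. 0 < s \<Longrightarrow> s \<le> t \<Longrightarrow> x \<in> U \<Longrightarrow> \<Phi> t x \<le> \<Phi> s x"
  shows "((\<lambda>t. exp (2 * \<Phi> t z)) \<longlongrightarrow> cmod (f z)) at_top"
proof -
  obtain V g where V: "open V" "z \<in> V" "V \<subseteq> U" and g: "g holomorphic_on V"
    "\<And>x. x \<in> V \<Longrightarrow> f x = exp (g x)"
    using holomorphic_local_log[OF U(1) f(1) U(2) f(2)] by metis
  have g2: "(\<lambda>x. g x / 2) holomorphic_on V" using g(1) by (intro holomorphic_intros) auto
  note Re_g = Re_holomorphic_harmonic[OF V(1) g2]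
  obtain r where r: "r > 0" "cball z r \<subseteq> V" using V by (meson open_contains_cball)
  define \<psi> where "\<psi> t x = \<Phi> t x - Re (g x / 2)" for t x
  have \<psi>_diff: "\<psi> t twice_differentiable_on V" if "t > 0" for t
    unfolding \<psi>_def
    by (rule twice_differentiable_on_diff(1)[OF V(1) twice_differentiable_on_subset[OF \<Phi>[OF that] V(3)] Re_g(1)])
  have exp_\<Phi>: "exp (2 * \<Phi> t x) = cmod (f x) * exp (2 * \<psi> t x)" if "x \<in> V" for t x
    using g(2)[OF that] by (simp add: \<psi>_def flip: exp_add)
  have f_pos: "cmod (f x) > 0" if "x \<in> V" for x using g(2)[OF that] by simp
  have \<psi>_nonneg: "0 \<le> \<psi> t x" if "t > 0" "x \<in> V" for t x
    using lower[OF that(1), of x] V(3) that(2) f_pos[OF that(2)] by (auto simp: exp_\<Phi>)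
  have cpt: "compact (cball z r)" "cball z r \<noteq> {}" using r(1) by auto
  have cont: "continuous_on (cball z r) (\<lambda>x. cmod (f x))"
    using holomorphic_on_imp_continuous_on[OF f(1)] r(2) V(3)
    by (intro continuous_on_norm) (meson continuous_on_subset order_trans)
  obtain y where y: "y \<in> cball z r" "\<And>x. x \<in> cball z r \<Longrightarrow> cmod (f y) \<le> cmod (f x)"
    using continuous_attains_inf[OF cpt cont] by blast
  define m where "m = cmod (f y)"
  have m: "m > 0" "\<And>x. x \<in> cball z r \<Longrightarrow> m \<le> cmod (f x)"
    using f_pos y r(2) by (auto simp: m_def)
  have \<psi>_cont: "continuous_on (cball z r) (\<psi> t)" if "t > 0" for t
    using twice_differentiable_imp_continuous_on[OF \<psi>_diff[OF that]] r(2) continuous_on_subset by blast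
  obtain y1 where y1: "y1 \<in> cball z r" "\<And>x. x \<in> cball z r \<Longrightarrow> \<psi> 1 x \<le> \<psi> 1 y1"
    using continuous_attains_sup[OF cpt \<psi>_cont[of 1]] by auto
  \<comment> \<open>As \<open>\<Phi> t\<close> decreases in \<open>t\<close>, the maximum of
    \<open>\<psi> 1\<close> on the disc bounds \<open>\<psi> t\<close> there for every
    \<open>t \<ge> 1\<close>.\<close>
  define M where "M = \<psi> 1 y1"
  have "M \<ge> 0" unfolding M_def using \<psi>_nonneg[of 1 y1] y1(1) r(2) by auto
  have \<psi>_M: "\<psi> t x \<le> M" if "t \<ge> 1" "x \<in> cball z r" for t x
    using y1(2)[OF that(2)] anti[of 1 t x] that r(2) V(3) unfolding M_def \<psi>_def by fastforce
  \<comment> \<open>Chosen so that \<open>2 * t * m * (K / t)\<close> equals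
    \<open>4 * M / r\<^sup>2\<close>, the Laplacian of the barrier \<open>b\<close> below.\<close>
  define K where "K = 2 * M / (r\<^sup>2 * m)"
  have "K \<ge> 0" using \<open>M \<ge> 0\<close> m(1) by (simp add: K_def)
  have bound: "\<psi> t z \<le> K / t" if "t \<ge> 1" for t
  proof -
    have "t > 0" using that by simp
    \<comment> \<open>a barrier: it dominates \<open>\<psi> t\<close> on the boundary of the disc, and its Laplacian is bounded
      independently of \<open>t\<close>, whereas that of \<open>\<psi> t\<close> is at least \<open>2 * t * m * \<psi> t\<close>\<close>
    define b where "b x = M / r\<^sup>2 * ((x - z) \<bullet> (x - z)) + K / t" for x
    note b1 = twice_differentiable_on_inner_self[OF V(1), where k = "M / r\<^sup>2" and z = z]
    note b2 = twice_differentiable_on_add[OF V(1) b1(1) twice_differentiable_on_const(1)[OF V(1), of "K / t"]]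
    have b: "b twice_differentiable_on V" unfolding b_def by (rule b2(1))
    have lap_b: "flat_laplacian b x = 4 * M / r\<^sup>2" if "x \<in> V" for x
      unfolding b_def using b2(2)[OF that] b1(2)[OF that] twice_differentiable_on_const(2)[OF V(1) that] by simp
    have "continuous_on (cball z r) (\<lambda>x. \<psi> t x - b x)"
      unfolding b_def by (intro continuous_intros \<psi>_cont \<open>t > 0\<close>)
    from continuous_attains_sup[OF cpt this]
    obtain x where x: "x \<in> cball z r" "\<And>y. y \<in> cball z r \<Longrightarrow> \<psi> t y - b y \<le> \<psi> t x - b x"
      by blast
    then have "x \<in> V" using r(2) by auto
    have "\<psi> t x \<le> b x"
    proof (cases "dist z x = r")
      case True
      then have "(x - z) \<bullet> (x - z) = r\<^sup>2"
        by (simp add: dist_norm norm_minus_commute flip: power2_norm_eq_inner)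
      \<comment> \<open>The coefficient \<open>M / r\<^sup>2\<close> makes the paraboloid alone
        reach the bound \<open>M\<close> on the boundary circle.\<close>
      then have "b x = M + K / t" using r(1) by (simp add: b_def)
      then show ?thesis using \<psi>_M[OF that x(1)] \<open>K \<ge> 0\<close> \<open>t > 0\<close> by (smt (verit) divide_nonneg_pos)
    next
      case False
      then have "x \<in> ball z r" using x(1) by auto
      have sub: "ball z r \<subseteq> V" using r(2) by auto
      \<comment> \<open>At an interior maximum of \<open>\<psi> t - b\<close> the Laplacian of
        \<open>\<psi> t\<close> is at most \<open>4 * M / r\<^sup>2\<close>. It is also at least
        \<open>2 * t * m * \<psi> t x\<close>, so \<open>\<psi> t x \<le> K / t\<close> by the
        choice of \<open>K\<close>.\<close>
      have "flat_laplacian (\<psi> t) x \<le> flat_laplacian b x"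
        by (rule flat_laplacian_le_at_local_max_diff[OF open_ball
              twice_differentiable_on_subset[OF \<psi>_diff[OF \<open>t > 0\<close>] sub]
              twice_differentiable_on_subset[OF b sub] \<open>x \<in> ball z r\<close>]) (use x(2) in auto)
      also have "flat_laplacian (\<psi> t) x = flat_laplacian (\<Phi> t) x"
        unfolding \<psi>_def
        using twice_differentiable_on_diff(2)[OF V(1)
            twice_differentiable_on_subset[OF \<Phi>[OF \<open>t > 0\<close>] V(3)] Re_g(1) \<open>x \<in> V\<close>]
          Re_g(2)[OF \<open>x \<in> V\<close>] by simp
      also have "\<dots> = t * cmod (f x) * (exp (2 * \<psi> t x) - exp (- 2 * \<psi> t x))"
      proof -
        have "exp (- 2 * \<Phi> t x) * (cmod (f x))\<^sup>2 = cmod (f x) * exp (- 2 * \<psi> t x)"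
          using exp_\<Phi>[OF \<open>x \<in> V\<close>, of t] f_pos[OF \<open>x \<in> V\<close>]
          by (simp add: exp_minus power2_eq_square field_simps)
        then show ?thesis
          using eq[OF \<open>t > 0\<close>, of x] V(3) \<open>x \<in> V\<close> exp_\<Phi>[OF \<open>x \<in> V\<close>, of t] by (auto simp: algebra_simps)
      qed
      finally have le: "t * cmod (f x) * (exp (2 * \<psi> t x) - exp (- 2 * \<psi> t x)) \<le> 4 * M / r\<^sup>2"
        by (simp add: lap_b[OF \<open>x \<in> V\<close>])
      note nn = \<psi>_nonneg[OF \<open>t > 0\<close> \<open>x \<in> V\<close>]
      \<comment> \<open>Here \<open>exp y \<ge> 1 + y\<close> is combined with
        \<open>exp (- 2 * \<psi> t x) \<le> 1\<close>, valid since \<open>\<psi> t x\<close> is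
        non-negative.\<close>
      have "2 * \<psi> t x \<le> exp (2 * \<psi> t x) - exp (- 2 * \<psi> t x)"
        using exp_ge_add_one_self[of "2 * \<psi> t x"] nn
        by (smt (verit) exp_le_one_iff)
      then have "t * m * (2 * \<psi> t x) \<le> t * cmod (f x) * (exp (2 * \<psi> t x) - exp (- 2 * \<psi> t x))"
        using m(1) m(2)[OF x(1)] \<open>t > 0\<close> nn by (intro mult_mono) auto
      with le have "t * m * (2 * \<psi> t x) \<le> 4 * M / r\<^sup>2" by simp
      then have "\<psi> t x \<le> K / t"
        using \<open>t > 0\<close> m(1) r(1) by (simp add: K_def field_simps)
      also have "K / t \<le> b x" using \<open>M \<ge> 0\<close> by (simp add: b_def)
      finally show ?thesis .
    qed
    \<comment> \<open>The comparison at the maximum extends to the centre, where the paraboloid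
      vanishes and \<open>b z\<close> is just \<open>K / t\<close>.\<close>
    then have "\<psi> t z - b z \<le> 0" using x(2)[of z] r(1) by simp
    then show ?thesis by (simp add: b_def)
  qed
  have "((\<lambda>t. \<psi> t z) \<longlongrightarrow> 0) at_top"
  proof (rule tendsto_sandwich[of "\<lambda>t. 0" _ _ "\<lambda>t. K / t"])
    show "\<forall>\<^sub>F t in at_top. 0 \<le> \<psi> t z"
      using eventually_gt_at_top[of 0] by eventually_elim (use \<psi>_nonneg V(2) in auto)
    show "\<forall>\<^sub>F t in at_top. \<psi> t z \<le> K / t"
      using eventually_ge_at_top[of 1] by eventually_elim (use bound in auto)
    show "((\<lambda>t. K / t) \<longlongrightarrow> 0) at_top"
      by (intro tendsto_divide_0[OF tendsto_const] filterlim_at_top_imp_at_infinity filterlim_ident)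
  qed simp
  then have "((\<lambda>t. cmod (f z) * exp (2 * \<psi> t z)) \<longlongrightarrow> cmod (f z) * exp (2 * 0)) at_top"
    by (intro tendsto_intros)
  then show ?thesis by (simp add: exp_\<Phi>[OF V(2)])
qed

section \<open>Uniqueness of the induced metric and the conclusion\<close>

text \<open>Some chart of \<open>Y\<close> contains the image point, and the pull-back formula in it
  fixes the value. This identifies the given \<open>I t\<close> with the conformal metric supplied
  by the parameterisation.\<close>

lemma induced_metric_unique:
  assumes X: "smooth_manifold X" and Y: "smooth_manifold Y"
    and f: "smooth_embedding X Y f" and I: "induced_metric X Y g f I" "induced_metric X Y g f J"
    and c: "c \<in> atlas X" "x \<in> cimg c"
  shows "I c x v w = J c x v w"
proof -
  obtain p where p: "p \<in> cdom c" "x = cmap c p" using c(2) by auto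
  have "continuous_map (mtop X) (mtop Y) f"
    using f unfolding smooth_embedding_def smooth_map_def by blast
  then have "f p \<in> topspace (mtop Y)"
    using p(1) chart_facts(5)[OF X c(1)] by (auto simp: continuous_map_def)
  then obtain d where d: "d \<in> atlas Y" "f p \<in> cdom d"
    using Y unfolding smooth_manifold_def by blast
  then have "x \<in> locdom c d f" using p by (auto simp: locdom_def)
  then show ?thesis using I c(1) d(1) unfolding induced_metric_def by metis
qed

theorem proposition3p10:
  fixes S :: "('a, complex) mfd"
    and \<tau> :: nat
    and h :: "('a, complex) tensor2"
    and C :: "('a, complex) chart set"
    and q1 :: "'a quad_diff"
    and M :: "real \<Rightarrow> ('b, real^3) mfd"
    and g :: "real \<Rightarrow> ('b, real^3) tensor2"
    and \<sigma> :: "real \<Rightarrow> 'a \<Rightarrow> 'b"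
    and I :: "real \<Rightarrow> ('a, complex) tensor2"
  assumes "closed_oriented_surface S"
    and "has_genus S \<tau>" and "\<tau> \<ge> 2"
    and "hyperbolic_metric S h"
    and "compatible_complex_structure S h C"
    and "holomorphic_quad_diff C q1"
    and "\<exists>c\<in>C. \<exists>z\<in>cimg c. q1 c z \<noteq> 0"
    and "\<And>t. t > 0 \<Longrightarrow>
           parameterised_by S h C (\<lambda>c z. of_real t * q1 c z) (M t) (g t) (\<sigma> t)"
    and "\<And>t. t > 0 \<Longrightarrow> induced_metric S (M t) (g t) (\<sigma> t) (I t)"
  shows "\<forall>c\<in>C. \<forall>z\<in>cimg c. q1 c z \<noteq> 0 \<longrightarrow>
           (\<forall>v. antimono_on {0<..} (\<lambda>t. I t c z v v / t)) \<and>
           (\<forall>v. \<forall>t>0. flat_metric q1 c z v v \<le> I t c z v v / t) \<and>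
           (\<forall>v w. ((\<lambda>t. I t c z v w / t) \<longlongrightarrow> flat_metric q1 c z v w) at_top)"
proof (intro ballI impI)
  fix c z assume c: "c \<in> C" and z: "z \<in> cimg c" and nz: "q1 c z \<noteq> 0"
  note surface = assms(1,4,5,6)
  have "\<exists>u. gauss_equation_sol S h C (\<lambda>c z. of_real t * q1 c z) u \<and>
      smooth_manifold (M t) \<and> smooth_embedding S (M t) (\<sigma> t) \<and>
      induced_metric S (M t) (g t) (\<sigma> t) (conformal_metric u h)" if t: "t > 0" for t
  proof -
    have "ghmc_ads_manifold (M t) (g t)"
      using assms(8)[OF t] unfolding parameterised_by_def by (rule conjunct1)
    then have "smooth_manifold (M t)" by (simp add: ghmc_ads_manifold_def ads_manifold_def)
    moreover obtain u B where "gauss_equation_sol S h C (\<lambda>c z. of_real t * q1 c z) u"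
      "maximal_surface S (M t) (g t) (\<sigma> t) (conformal_metric u h) B"
      using assms(8)[OF t] unfolding parameterised_by_def by (elim conjE exE)
    ultimately show ?thesis unfolding maximal_surface_def by (intro exI[of _ u]) simp
  qed
  \<comment> \<open>One solution of the Gauss equation is selected for each \<open>t > 0\<close>;
    the comparison lemmas hold for any such selection.\<close>
  then obtain u where u: "\<And>t. t > 0 \<Longrightarrow> gauss_equation_sol S h C (\<lambda>c z. of_real t * q1 c z) (u t)"
    and M: "\<And>t. t > 0 \<Longrightarrow> smooth_manifold (M t) \<and> smooth_embedding S (M t) (\<sigma> t) \<and>
      induced_metric S (M t) (g t) (\<sigma> t) (conformal_metric (u t) h)"
    by metis
  have S: "smooth_manifold S" "c \<in> atlas S"
    using assms(1,5) c unfolding closed_oriented_surface_def compatible_complex_structure_def by auto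
  define \<Phi> where "\<Phi> t = log_factor h (u t) t c" for t
  have I: "I t c z v w / t = exp (2 * \<Phi> t z) * (v \<bullet> w)" if "t > 0" for t v w
  proof -
    have "I t c z v w = conformal_metric (u t) h c z v w"
      using induced_metric_unique[OF S(1) _ _ assms(9)[OF that] _ S(2) z] M[OF that] by blast
    then show ?thesis
      unfolding \<Phi>_def using conformal_metric_log_factor[OF surface c z that] by simp
  qed
  have lower: "cmod (q1 c x) \<le> exp (2 * \<Phi> t x)" if "t > 0" "x \<in> cimg c" for t x
    unfolding \<Phi>_def by (rule metric_ge_flat_metric[OF surface u[OF that(1)] that(1) c that(2)])
  have anti: "\<Phi> t x \<le> \<Phi> s x" if "0 < s" "s \<le> t" "x \<in> cimg c" for s t x
    unfolding \<Phi>_def using that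
    by (intro log_factor_antimono[OF surface u[OF that(1)] that(1) u _ c]) auto
  have "q1 c holomorphic_on cimg c" using assms(6) c unfolding holomorphic_quad_diff_def by blast
  then have lim: "((\<lambda>t. exp (2 * \<Phi> t z)) \<longlongrightarrow> cmod (q1 c z)) at_top"
    by (rule tendsto_of_laplacian_equation[OF chart_facts(2)[OF S] z])
      (use nz lower anti gauss_equation_chart[OF surface u _ c] in \<open>auto simp: \<Phi>_def\<close>)
  show "(\<forall>v. antimono_on {0<..} (\<lambda>t. I t c z v v / t)) \<and>
      (\<forall>v. \<forall>t>0. flat_metric q1 c z v v \<le> I t c z v v / t) \<and>
      (\<forall>v w. ((\<lambda>t. I t c z v w / t) \<longlongrightarrow> flat_metric q1 c z v w) at_top)"
  proof (intro conjI allI impI)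
    show "antimono_on {0<..} (\<lambda>t. I t c z v v / t)" for v
      by (rule monotone_onI) (auto simp: I intro!: mult_right_mono anti z)
    show "flat_metric q1 c z v v \<le> I t c z v v / t" if "t > 0" for v t
      unfolding flat_metric_def I[OF that] by (intro mult_right_mono lower that z) auto
    show "((\<lambda>t. I t c z v w / t) \<longlongrightarrow> flat_metric q1 c z v w) at_top" for v w
    proof (rule Lim_transform_eventually)
      show "((\<lambda>t. exp (2 * \<Phi> t z) * (v \<bullet> w)) \<longlongrightarrow> flat_metric q1 c z v w) at_top"
        unfolding flat_metric_def by (intro tendsto_intros lim)
      show "\<forall>\<^sub>F t in at_top. exp (2 * \<Phi> t z) * (v \<bullet> w) = I t c z v w / t"
        using eventually_gt_at_top[of 0] by eventually_elim (simp add: I)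
    qed
  qed
qed

end
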